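(* Let $\widehat\Gamma:\widehat{\mathcal K}\times\mathbb D_1\to L(Y)$ and $\Gamma:\mathcal K\times\mathbb D_1\to L(Y)$ be appropriate. Let a biholomorphic mapping $h\in\mathrm{Hol}(\mathbb D_1,X)$ be convex in the direction $\tau$, where $\tau\in\partial\mathbb D_1$. Suppose that $h+t\tau\in\mathcal K$ for all $t\ge 0$ and that there is $C\in L(Y)$ such that $$\Gamma(h+t\tau,x)=e^{-Ct}\,\Gamma(h,x)\quad\text{for all } t\ge 0\text{ and }x\in\mathbb D_1 .$$ Let $\Phi[h]:\mathbb D\to Z$ be defined by $\Phi[h](x,y)=(h(x),\Gamma(h,x)y)$. Then for each point $(z,w)\in\Phi[h](\mathbb D)$, the set $\Phi[h](\mathbb D)$ contains the curve $$\left\{\left(z+t\tau,\ e^{-(B+C)t}w\right):\ t\ge 0\right\}$$ for any accretive operator $B\in L(Y)$ which commutes with $C$ and with $\Gamma(h,x)$ for all $x\in\mathbb D_1$ and is such that the function $\mathrm{Re}\,\lambda$ is non-negative on the spectrum of $B+C$. In particular, if $\Gamma(h+t\tau,x)=\Gamma(h,x)$ for all $t\ge 0$ and $x\in\mathbb D_1$, then the mapping $\Phi[h]$ is convex in the direction $(\tau,0)$.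
   Context: Setting. $X,Y$ are complex Banach spaces with norms $\|\cdot\|_X,\|\cdot\|_Y$ and open unit balls $\mathbb D_1\subset X$, $\mathbb D_2\subset Y$. $L(Y)$ denotes the bounded linear operators on $Y$. $\mathrm{Hol}(D,E)$ is the set of holomorphic mappings on a domain $D$ with values in $E$; $\mathrm{Hol}(D)=\mathrm{Hol}(D,D)$. Biholomorphic means: injective holomorphic with open image and holomorphic inverse on the image. $p:[0,1]\to[0,1]$ is a continuous, strictly decreasing function with $p(0)=1$, $p(1)=0$ and $p\left(\frac{s_1+s_2}{2}\right)\ge\frac12(p(s_1)+p(s_2))$ for all $s_1,s_2\in[0,1]$. On $Z=X\times Y$ one uses the norm (Minkowski functional) whose open unit ball is $$\mathbb D=\{(x,y)\in\mathbb D_1\times\mathbb D_2:\ \|y\|_Y<p(\|x\|_X)\}.$$ Appropriate $\widehat\Gamma$. Let $\widehat{\mathcal K}\subset\mathrm{Hol}(\mathbb D_1)$ consist of biholomorphic mappings (onto their images) and be closed under composition; let $\widehat\Gamma:\widehat{\mathcal K}\times\mathbb D_1\to L(Y)$ be continuous in the first variable (for each fixed $x$, with $\widehat{\mathcal K}$ carrying the topology of pointwise convergence on $\mathbb D_1$) and holomorphic in the second. $\widehat\Gamma$ is appropriate if: (i) $\mathrm{id}_X\in\widehat{\mathcal K}$ and $\widehat\Gamma(\mathrm{id}_X,x)=\mathrm{id}_Y$; (ii) $\widehat\Gamma(f,g(x))\widehat\Gamma(g,x)=\widehat\Gamma(f\circ g,x)$ for all $f,g\in\widehat{\mathcal K}$,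 $x\in\mathbb D_1$; (iii) $\widehat\Gamma(f,x)$ is invertible for all $f\in\widehat{\mathcal K}$, $x\in\mathbb D_1$; (iv) $\|\widehat\Gamma(f,x)\|_{L(Y)}\le p(\|f(x)\|_X)/p(\|x\|_X)$ for all $f\in\widehat{\mathcal K}$, $x\in\mathbb D_1$. Appropriate $\Gamma$. Given $\widehat{\mathcal K}$ and an appropriate $\widehat\Gamma$, let $\mathcal K\subset\mathrm{Hol}(\mathbb D_1,X)$ be a non-empty set of biholomorphic mappings and $\Gamma:\mathcal K\times\mathbb D_1\to L(Y)$ be continuous in the first variable (for each fixed $x$, with the topology of locally uniform convergence on $\mathcal K$) and holomorphic in the second. $\Gamma$ is appropriate if: (i) for all $h_1,h_2\in\mathcal K$ with $h_1(\mathbb D_1)\subset h_2(\mathbb D_1)$, $h_2^{-1}\circ h_1\in\widehat{\mathcal K}$; (ii) for all $h\in\mathcal K$, $g\in\widehat{\mathcal K}$, $x\in\mathbb D_1$: $h\circ g\in\mathcal K$ and $\Gamma(h,g(x))\widehat\Gamma(g,x)=\Gamma(h\circ g,x)$; (iii) $\Gamma(h,x)$ is invertible for all $h\in\mathcal K$, $x\in\mathbb D_1$. Convexity in one direction. Let $h$ be a biholomorphic mapping on a domain $D$ of a Banach space $E$, with values in $E$, and let $\tau\in E$, $\|\tau\|=1$. Then $h$ is convex in the direction $\tau$ if $w+t\tau\in h(D)$ for each $w\in h(D)$ and $t\ge0$. This is applied with $E=X$, $D=\mathbb D_1$ and with $E=Z$, $D=\mathbb D$. A bounded operator $B\in L(Y)$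 is accretive if $\mathrm{Re}\,\ell(By)\ge0$ for all $y\in Y$ with $\|y\|_Y=1$ and all $\ell\in Y^*$ with $\|\ell\|=\ell(y)=1$; equivalently $\|e^{-tB}\|_{L(Y)}\le 1$ for all $t\ge 0$. *)

theory Defs
  imports "HOL-Analysis.Analysis" "HOL-Library.FuncSet"
begin

section \<open>Complex Banach spaces\<close>

class scaleC =
  fixes scaleC :: "complex \<Rightarrow> 'a \<Rightarrow> 'a"  (infixr \<open>*\<^sub>C\<close> 75)

class complex_normed_vector = real_normed_vector + scaleC +
  assumes scaleR_scaleC: "r *\<^sub>R x = complex_of_real r *\<^sub>C x"
    and scaleC_add_right: "a *\<^sub>C (x + y) = a *\<^sub>C x + a *\<^sub>C y"
    and scaleC_add_left: "(a + b) *\<^sub>C x = a *\<^sub>C x + b *\<^sub>C x"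
    and scaleC_scaleC: "a *\<^sub>C b *\<^sub>C x = (a * b) *\<^sub>C x"
    and norm_scaleC: "norm (a *\<^sub>C x) = cmod a * norm x"

class complex_banach = complex_normed_vector + banach

definition complex_linear ::
  "('a::complex_normed_vector \<Rightarrow> 'b::complex_normed_vector) \<Rightarrow> bool" where
  "complex_linear f \<longleftrightarrow>
     (\<forall>x y. f (x + y) = f x + f y) \<and> (\<forall>c x. f (c *\<^sub>C x) = c *\<^sub>C f x)"

instantiation complex :: complex_banach
begin
definition scaleC_complex :: "complex \<Rightarrow> complex \<Rightarrow> complex" where
  "scaleC_complex c z = c * z"
instance
  by standard (simp_all add: scaleC_complex_def algebra_simps scaleR_conv_of_real norm_mult)
end

text \<open>The product carries the Euclidean product norm of the library.  It only serves to fix the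
  (product) topology and the notion of derivative; the norm used on \<open>X \<times> Y\<close> is the
  Minkowski functional of the domain \<open>DD p\<close> below, which is an equivalent norm.\<close>

instantiation prod :: (complex_normed_vector, complex_normed_vector) complex_normed_vector
begin
definition scaleC_prod :: "complex \<Rightarrow> 'a \<times> 'b \<Rightarrow> 'a \<times> 'b" where
  "scaleC_prod c z = (c *\<^sub>C fst z, c *\<^sub>C snd z)"
instance
proof
  fix a :: complex and x :: "'a \<times> 'b"
  have "norm (a *\<^sub>C x) = sqrt ((cmod a)\<^sup>2 * ((norm (fst x))\<^sup>2 + (norm (snd x))\<^sup>2))"
    by (simp add: scaleC_prod_def norm_prod_def norm_scaleC power_mult_distrib algebra_simps)
  then show "norm (a *\<^sub>C x) = cmod a * norm x"
    by (simp add: real_sqrt_mult norm_prod_def)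
qed (simp_all add: scaleC_prod_def scaleR_prod_def scaleR_scaleC scaleC_add_right
       scaleC_add_left scaleC_scaleC)
end

lemma bounded_linear_scaleC_right:
  "bounded_linear (\<lambda>x::'a::complex_normed_vector. c *\<^sub>C x)"
  by (rule bounded_linear_intro[where K = "cmod c"])
     (simp_all add: scaleC_add_right norm_scaleC scaleR_scaleC scaleC_scaleC mult.commute)

text \<open>The real-linear bounded operators into a complex space form a complex space in which
  the complex-linear ones (\<open>L_ops\<close> below) are a closed complex subspace.\<close>

instantiation blinfun :: (real_normed_vector, complex_normed_vector) complex_normed_vector
begin
lift_definition scaleC_blinfun :: "complex \<Rightarrow> ('a \<Rightarrow>\<^sub>L 'b) \<Rightarrow> ('a \<Rightarrow>\<^sub>L 'b)" is
  "\<lambda>c T x. c *\<^sub>C T x"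
  by (rule bounded_linear_compose[OF bounded_linear_scaleC_right])
instance
proof
  fix a :: complex and T :: "'a \<Rightarrow>\<^sub>L 'b"
  have le: "norm (c *\<^sub>C S) \<le> cmod c * norm S" for c and S :: "'a \<Rightarrow>\<^sub>L 'b"
  proof (rule norm_blinfun_bound)
    fix x
    have "cmod c * norm (blinfun_apply S x) \<le> cmod c * (norm S * norm x)"
      by (intro mult_left_mono norm_blinfun) simp
    then show "norm (blinfun_apply (c *\<^sub>C S) x) \<le> cmod c * norm S * norm x"
      by (simp add: scaleC_blinfun.rep_eq norm_scaleC mult.assoc)
  qed simp
  show "norm (a *\<^sub>C T) = cmod a * norm T"
  proof (cases "a = 0")
    case True
    then show ?thesis using le[of 0 T] by simp
  next
    case False
    have one: "1 *\<^sub>C S = S" for S :: "'a \<Rightarrow>\<^sub>L 'b"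
      by (rule blinfun_eqI)
         (metis of_real_1 scaleC_blinfun.rep_eq scaleR_one scaleR_scaleC)
    have "inverse a *\<^sub>C (a *\<^sub>C T) = (inverse a * a) *\<^sub>C T"
      by (rule blinfun_eqI) (simp add: scaleC_blinfun.rep_eq scaleC_scaleC)
    with False have "inverse a *\<^sub>C (a *\<^sub>C T) = T" by (simp add: one)
    with le[of "inverse a" "a *\<^sub>C T"] have "norm T \<le> norm (a *\<^sub>C T) / cmod a"
      by (simp add: norm_inverse divide_inverse mult.commute)
    with False have "cmod a * norm T \<le> norm (a *\<^sub>C T)"
      by (simp add: field_simps)
    with le[of a T] show ?thesis by simp
  qed
qed (rule blinfun_eqI, simp add: scaleC_blinfun.rep_eq blinfun.add_left blinfun.scaleR_left
       scaleR_scaleC scaleC_add_right scaleC_add_left scaleC_scaleC)+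
end


section \<open>Bounded complex-linear operators\<close>

definition L_ops :: "('y::complex_banach \<Rightarrow>\<^sub>L 'y) set" where
  "L_ops = {T. complex_linear (blinfun_apply T)}"

definition L_invertible :: "('y::complex_banach \<Rightarrow>\<^sub>L 'y) \<Rightarrow> bool" where
  "L_invertible T \<longleftrightarrow> (\<exists>S\<in>L_ops. S o\<^sub>L T = id_blinfun \<and> T o\<^sub>L S = id_blinfun)"

definition L_spectrum :: "('y::complex_banach \<Rightarrow>\<^sub>L 'y) \<Rightarrow> complex set" where
  "L_spectrum T = {\<mu>. \<not> L_invertible (\<mu> *\<^sub>C id_blinfun - T)}"

definition L_exp :: "('y::complex_banach \<Rightarrow>\<^sub>L 'y) \<Rightarrow> ('y \<Rightarrow>\<^sub>L 'y)" where
  "L_exp T = (\<Sum>n. (1 / fact n) *\<^sub>R ((\<lambda>S. T o\<^sub>L S) ^^ n) id_blinfun)"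

definition accretive :: "('y::complex_banach \<Rightarrow>\<^sub>L 'y) \<Rightarrow> bool" where
  "accretive B \<longleftrightarrow>
     (\<forall>y (l :: 'y \<Rightarrow>\<^sub>L complex).
        norm y = 1 \<and> complex_linear (blinfun_apply l) \<and> norm l = 1 \<and> blinfun_apply l y = 1
        \<longrightarrow> 0 \<le> Re (blinfun_apply l (blinfun_apply B y)))"


section \<open>Holomorphic and biholomorphic mappings\<close>

definition holomorphic_map_on ::
  "('a::complex_normed_vector \<Rightarrow> 'b::complex_normed_vector) \<Rightarrow> 'a set \<Rightarrow> bool" where
  "holomorphic_map_on f D \<longleftrightarrow>
     open D \<and> (\<forall>x\<in>D. \<exists>A. complex_linear A \<and> (f has_derivative A) (at x))"

text \<open>Mappings with domain \<open>D\<close> are represented as elements of \<open>extensional D\<close>, so that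
  equality of functions is equality on \<open>D\<close>; accordingly they are composed with
  \<^const>\<open>compose\<close>.\<close>

definition Hol ::
  "'a::complex_normed_vector set \<Rightarrow> 'b::complex_normed_vector set \<Rightarrow> ('a \<Rightarrow> 'b) set" where
  "Hol D E = {f \<in> D \<rightarrow>\<^sub>E E. holomorphic_map_on f D}"

definition biholomorphic_on ::
  "('a::complex_normed_vector \<Rightarrow> 'b::complex_normed_vector) \<Rightarrow> 'a set \<Rightarrow> bool" where
  "biholomorphic_on f D \<longleftrightarrow>
     inj_on f D \<and> holomorphic_map_on f D \<and>
     open (f ` D) \<and> holomorphic_map_on (inv_into D f) (f ` D)"

text \<open>The norm \<open>N\<close> is a parameter because the norm on \<open>X \<times> Y\<close> is not the one of the
  type class.\<close>

definition convex_in_direction ::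
  "('e::complex_normed_vector \<Rightarrow> real) \<Rightarrow> 'e set \<Rightarrow> ('e \<Rightarrow> 'e) \<Rightarrow> 'e \<Rightarrow> bool" where
  "convex_in_direction N D h \<tau> \<longleftrightarrow>
     open D \<and> connected D \<and> biholomorphic_on h D \<and> N \<tau> = 1 \<and>
     (\<forall>w\<in>h ` D. \<forall>t\<ge>0. w + t *\<^sub>R \<tau> \<in> h ` D)"


section \<open>The domain in the product space\<close>

abbreviation unit_ball :: "'a::real_normed_vector set" where
  "unit_ball \<equiv> ball 0 1"

definition admissible_p :: "(real \<Rightarrow> real) \<Rightarrow> bool" where
  "admissible_p p \<longleftrightarrow>
     p \<in> {0..1} \<rightarrow> {0..1} \<and> continuous_on {0..1} p \<and> strict_antimono_on {0..1} p \<and>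
     p 0 = 1 \<and> p 1 = 0 \<and>
     (\<forall>s1\<in>{0..1}. \<forall>s2\<in>{0..1}. p ((s1 + s2) / 2) \<ge> (p s1 + p s2) / 2)"

definition DD :: "(real \<Rightarrow> real) \<Rightarrow> ('x::complex_banach \<times> 'y::complex_banach) set" where
  "DD p = {(x, y). x \<in> unit_ball \<and> y \<in> unit_ball \<and> norm y < p (norm x)}"

definition minkowski_functional :: "'a::real_vector set \<Rightarrow> 'a \<Rightarrow> real" where
  "minkowski_functional S z = Inf {r. 0 < r \<and> z \<in> (\<lambda>v. r *\<^sub>R v) ` S}"


section \<open>Topologies on sets of mappings\<close>

definition pointwise_topology ::
  "('x::real_normed_vector \<Rightarrow> 'z::topological_space) set \<Rightarrow> ('x \<Rightarrow> 'z) topology" where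
  "pointwise_topology K = subtopology (product_topology (\<lambda>_. euclidean) unit_ball) K"

text \<open>Locally uniform convergence on the unit ball is taken, as is usual for holomorphic
  mappings on Banach spaces, as uniform convergence on each ball lying strictly inside it.\<close>

definition locally_uniform_topology ::
  "('x::real_normed_vector \<Rightarrow> 'z::metric_space) set \<Rightarrow> ('x \<Rightarrow> 'z) topology" where
  "locally_uniform_topology K = topology (\<lambda>U. U \<subseteq> K \<and>
     (\<forall>f\<in>U. \<exists>r \<epsilon>. 0 < r \<and> r < 1 \<and> 0 < \<epsilon> \<and>
        (\<forall>g\<in>K. (\<forall>x\<in>cball 0 r. dist (g x) (f x) < \<epsilon>) \<longrightarrow> g \<in> U)))"

lemma openin_locally_uniform_topology:
  "openin (locally_uniform_topology K) U \<longleftrightarrow> U \<subseteq> K \<and>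
     (\<forall>f\<in>U. \<exists>r \<epsilon>. 0 < r \<and> r < 1 \<and> 0 < \<epsilon> \<and>
        (\<forall>g\<in>K. (\<forall>x\<in>cball 0 r. dist (g x) (f x) < \<epsilon>) \<longrightarrow> g \<in> U))"
proof -
  define P where "P = (\<lambda>U. U \<subseteq> K \<and>
     (\<forall>f\<in>U. \<exists>r \<epsilon>. 0 < r \<and> r < 1 \<and> 0 < \<epsilon> \<and>
        (\<forall>g\<in>K. (\<forall>x\<in>cball 0 r. dist (g x) (f x) < \<epsilon>) \<longrightarrow> g \<in> U)))"
  have "istopology P"
    unfolding istopology_def
  proof (intro conjI allI impI)
    fix S T assume S: "P S" and T: "P T"
    show "P (S \<inter> T)"
      unfolding P_def
    proof (intro conjI ballI)
      show "S \<inter> T \<subseteq> K" using S unfolding P_def by blast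
      fix f assume f: "f \<in> S \<inter> T"
      obtain r1 e1 where 1: "0 < r1" "r1 < 1" "0 < e1"
        "\<And>g. g \<in> K \<Longrightarrow> (\<forall>x\<in>cball 0 r1. dist (g x) (f x) < e1) \<Longrightarrow> g \<in> S"
        using S f unfolding P_def by (metis IntD1)
      obtain r2 e2 where 2: "0 < r2" "r2 < 1" "0 < e2"
        "\<And>g. g \<in> K \<Longrightarrow> (\<forall>x\<in>cball 0 r2. dist (g x) (f x) < e2) \<Longrightarrow> g \<in> T"
        using T f unfolding P_def by (metis IntD2)
      show "\<exists>r \<epsilon>. 0 < r \<and> r < 1 \<and> 0 < \<epsilon> \<and>
        (\<forall>g\<in>K. (\<forall>x\<in>cball 0 r. dist (g x) (f x) < \<epsilon>) \<longrightarrow> g \<in> S \<inter> T)"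
      proof (rule exI[of _ "max r1 r2"], rule exI[of _ "min e1 e2"], intro conjI ballI impI)
        fix g assume "g \<in> K" "\<forall>x\<in>cball 0 (max r1 r2). dist (g x) (f x) < min e1 e2"
        then show "g \<in> S \<inter> T" using 1(4)[of g] 2(4)[of g] by auto
      qed (use 1 2 in auto)
    qed
  next
    fix \<U> assume U: "\<forall>S\<in>\<U>. P S"
    show "P (\<Union>\<U>)"
      unfolding P_def
    proof (intro conjI ballI)
      show "\<Union>\<U> \<subseteq> K" using U unfolding P_def by blast
      fix f assume "f \<in> \<Union>\<U>"
      then obtain S where S: "S \<in> \<U>" "f \<in> S" by blast
      with U have "P S" by blast
      with S(2) obtain r e where re: "0 < r" "r < 1" "0 < e"
        "\<And>g. g \<in> K \<Longrightarrow> (\<forall>x\<in>cball 0 r. dist (g x) (f x) < e) \<Longrightarrow> g \<in> S"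
        unfolding P_def by metis
      show "\<exists>r \<epsilon>. 0 < r \<and> r < 1 \<and> 0 < \<epsilon> \<and>
        (\<forall>g\<in>K. (\<forall>x\<in>cball 0 r. dist (g x) (f x) < \<epsilon>) \<longrightarrow> g \<in> \<Union>\<U>)"
      proof (rule exI[of _ r], rule exI[of _ e], intro conjI ballI impI)
        fix g assume "g \<in> K" "\<forall>x\<in>cball 0 r. dist (g x) (f x) < e"
        then show "g \<in> \<Union>\<U>" using re(4)[of g] S(1) by blast
      qed (use re in auto)
    qed
  qed
  then have "openin (topology P) U = P U" by simp
  then show ?thesis unfolding locally_uniform_topology_def P_def .
qed


section \<open>Appropriate operator families\<close>

definition appropriate_hat ::
  "(real \<Rightarrow> real) \<Rightarrow> ('x::complex_banach \<Rightarrow> 'x) set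
    \<Rightarrow> (('x \<Rightarrow> 'x) \<Rightarrow> 'x \<Rightarrow> ('y::complex_banach \<Rightarrow>\<^sub>L 'y)) \<Rightarrow> bool" where
  "appropriate_hat p Kh \<Gamma>h \<longleftrightarrow>
     Kh \<subseteq> Hol unit_ball unit_ball \<and>
     (\<forall>f\<in>Kh. biholomorphic_on f unit_ball) \<and>
     (\<forall>f\<in>Kh. \<forall>g\<in>Kh. compose unit_ball f g \<in> Kh) \<and>
     (\<forall>f\<in>Kh. \<forall>x\<in>unit_ball. \<Gamma>h f x \<in> L_ops) \<and>
     (\<forall>x\<in>unit_ball. continuous_map (pointwise_topology Kh) euclidean (\<lambda>f. \<Gamma>h f x)) \<and>
     (\<forall>f\<in>Kh. holomorphic_map_on (\<Gamma>h f) unit_ball) \<and>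
     restrict id unit_ball \<in> Kh \<and>
     (\<forall>x\<in>unit_ball. \<Gamma>h (restrict id unit_ball) x = id_blinfun) \<and>
     (\<forall>f\<in>Kh. \<forall>g\<in>Kh. \<forall>x\<in>unit_ball.
        \<Gamma>h f (g x) o\<^sub>L \<Gamma>h g x = \<Gamma>h (compose unit_ball f g) x) \<and>
     (\<forall>f\<in>Kh. \<forall>x\<in>unit_ball. L_invertible (\<Gamma>h f x)) \<and>
     (\<forall>f\<in>Kh. \<forall>x\<in>unit_ball. norm (\<Gamma>h f x) \<le> p (norm (f x)) / p (norm x))"

definition appropriate ::
  "('x::complex_banach \<Rightarrow> 'x) set \<Rightarrow> (('x \<Rightarrow> 'x) \<Rightarrow> 'x \<Rightarrow> ('y::complex_banach \<Rightarrow>\<^sub>L 'y))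
    \<Rightarrow> ('x \<Rightarrow> 'x) set \<Rightarrow> (('x \<Rightarrow> 'x) \<Rightarrow> 'x \<Rightarrow> ('y \<Rightarrow>\<^sub>L 'y)) \<Rightarrow> bool" where
  "appropriate Kh \<Gamma>h K \<Gamma> \<longleftrightarrow>
     K \<subseteq> Hol unit_ball UNIV \<and> K \<noteq> {} \<and>
     (\<forall>h\<in>K. biholomorphic_on h unit_ball) \<and>
     (\<forall>h\<in>K. \<forall>x\<in>unit_ball. \<Gamma> h x \<in> L_ops) \<and>
     (\<forall>x\<in>unit_ball. continuous_map (locally_uniform_topology K) euclidean (\<lambda>h. \<Gamma> h x)) \<and>
     (\<forall>h\<in>K. holomorphic_map_on (\<Gamma> h) unit_ball) \<and>
     (\<forall>h1\<in>K. \<forall>h2\<in>K. h1 ` unit_ball \<subseteq> h2 ` unit_ball \<longrightarrow>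
        compose unit_ball (inv_into unit_ball h2) h1 \<in> Kh) \<and>
     (\<forall>h\<in>K. \<forall>g\<in>Kh. \<forall>x\<in>unit_ball.
        compose unit_ball h g \<in> K \<and>
        \<Gamma> h (g x) o\<^sub>L \<Gamma>h g x = \<Gamma> (compose unit_ball h g) x) \<and>
     (\<forall>h\<in>K. \<forall>x\<in>unit_ball. L_invertible (\<Gamma> h x))"

definition translate ::
  "('x::complex_banach \<Rightarrow> 'x) \<Rightarrow> 'x \<Rightarrow> ('x \<Rightarrow> 'x)" where
  "translate h v = (\<lambda>x\<in>unit_ball. h x + v)"

definition extension_op ::
  "(real \<Rightarrow> real) \<Rightarrow> (('x::complex_banach \<Rightarrow> 'x) \<Rightarrow> 'x \<Rightarrow> ('y::complex_banach \<Rightarrow>\<^sub>L 'y))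
    \<Rightarrow> ('x \<Rightarrow> 'x) \<Rightarrow> ('x \<times> 'y \<Rightarrow> 'x \<times> 'y)" where
  "extension_op p \<Gamma> h = (\<lambda>(x, y)\<in>DD p. (h x, blinfun_apply (\<Gamma> h x) y))"

end

(* Since h is convex in the direction tau, g = h^-1 o (h + t tau) is a self-map of the unit ball,
   and Phi[h] sends (g x, Gamma^(g, x) e^(-tB) y) to (h x + t tau, e^(-t(B+C)) Gamma(h, x) y) by
   the cocycle identities.  That point lies in DD p because the norm of Gamma^(g, x) is at most
   p |g x| / p |x| and e^(-tB) is a contraction.  The latter rests on |v| <= |(1 + sB) v|, which
   follows from accretivity applied to a norming functional of v. *)

theory Submission
  imports Defs
begin

section \<open>The exponential of a bounded operator\<close>

text \<open>\<open>accretive\<close> quantifies over norming functionals, so it yields an estimate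
  only once such functionals are known to exist; hence a Hahn-Banach theorem for real sublinear
  functionals, complexified afterwards. To pass from |v| <= |(1 + sB) v| to contractivity without
  inverting 1 + sB, the product (1 + sB) e^(-sB) is used: its derivative at s = 0 vanishes, so
  |e^(-sB)| <= 1 + o(s), and the semigroup law carries this from small s to every t >= 0. Only a
  real parameter occurs, so the exponential is treated as a curve of operators in a real variable
  and its algebraic laws come from differential equations. The final convexity claim is the case B =
  C = 0, where the curve is a ray. However, \<open>convex_in_direction\<close> also demands that
  \<Phi>[h] be biholomorphic on a connected open set and that the direction have Minkowski norm 1;
  this accounts for the explicit inverse of a fibrewise linear map and for the study of
  \<open>DD p\<close>.\<close>

abbreviation blinfun_pow :: "('a::real_normed_vector \<Rightarrow>\<^sub>L 'a) \<Rightarrow> nat \<Rightarrow> ('a \<Rightarrow>\<^sub>L 'a)" where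
  "blinfun_pow A n \<equiv> ((\<lambda>S. A o\<^sub>L S) ^^ n) id_blinfun"

text \<open>Already at \<open>n = 0\<close> only an inequality holds, because the identity of the
  zero space has norm 0.\<close>

lemma norm_blinfun_pow_le: "norm (blinfun_pow A n) \<le> norm A ^ n"
proof (induction n)
  case 0
  show ?case by (simp add: norm_blinfun_id_le)
next
  case (Suc n)
  have "norm (A o\<^sub>L blinfun_pow A n) \<le> norm A * norm A ^ n"
    by (rule order_trans[OF norm_blinfun_compose mult_left_mono[OF Suc.IH norm_ge_zero]])
  then show ?case by simp
qed

lemma blinfun_compose_scaleR_left: "(c *\<^sub>R A) o\<^sub>L B = c *\<^sub>R (A o\<^sub>L B)"
  by (rule bounded_bilinear.scaleR_left[OF bounded_bilinear_blinfun_compose])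

lemma blinfun_compose_scaleR_right: "A o\<^sub>L (c *\<^sub>R B) = c *\<^sub>R (A o\<^sub>L B)"
  by (rule bounded_bilinear.scaleR_right[OF bounded_bilinear_blinfun_compose])

lemma blinfun_compose_assoc: "(A o\<^sub>L B) o\<^sub>L C = A o\<^sub>L (B o\<^sub>L C)"
  by (rule blinfun_eqI) simp

lemma blinfun_compose_id [simp]: "id_blinfun o\<^sub>L A = A" "A o\<^sub>L id_blinfun = A"
  by (auto intro: blinfun_eqI)

lemma blinfun_pow_scaleR: "blinfun_pow (t *\<^sub>R A) n = t ^ n *\<^sub>R blinfun_pow A n"
  by (induction n) (auto simp: blinfun_compose_scaleR_left blinfun_compose_scaleR_right mult.commute)

text \<open>Exhibits the exponential as a power series in the real variable \<open>t\<close> with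
  fixed operator coefficients, the form in which it can be differentiated term by term.\<close>

lemma L_exp_scaleR:
  "L_exp (t *\<^sub>R A) = (\<Sum>n. t ^ n *\<^sub>R (1 / fact n) *\<^sub>R blinfun_pow A n)"
  by (simp add: L_exp_def blinfun_pow_scaleR mult.commute)

text \<open>The majorant is a term of the real series for exp (R |A|) and does not depend on
  \<open>t\<close>, as the Weierstrass test requires.\<close>

lemma norm_L_exp_term_le:
  assumes "\<bar>t\<bar> \<le> R"
  shows "norm (t ^ n *\<^sub>R (1 / fact n) *\<^sub>R blinfun_pow A n) \<le> inverse (fact n) * (R * norm A) ^ n"
proof -
  have "\<bar>t\<bar> ^ n * norm (blinfun_pow A n) \<le> R ^ n * norm A ^ n"
    using assms by (intro mult_mono power_mono norm_blinfun_pow_le) auto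
  then have "inverse (fact n) * (\<bar>t\<bar> ^ n * norm (blinfun_pow A n)) \<le> inverse (fact n) * (R ^ n * norm A ^ n)"
    by (intro mult_left_mono) auto
  then show ?thesis by (simp add: abs_mult power_abs power_mult_distrib divide_inverse mult_ac)
qed

lemma uniform_limit_L_exp:
  "uniform_limit (cball 0 R) (\<lambda>n t. \<Sum>i<n. t ^ i *\<^sub>R (1 / fact i) *\<^sub>R blinfun_pow A i)
     (\<lambda>t. L_exp (t *\<^sub>R A)) sequentially"
  unfolding L_exp_scaleR
proof (rule Weierstrass_m_test)
  show "summable (\<lambda>n. inverse (fact n) * (R * norm A) ^ n)"
    using summable_exp by blast
qed (use norm_L_exp_term_le in auto)

lemma L_exp_sums: "(\<lambda>n. t ^ n *\<^sub>R (1 / fact n) *\<^sub>R blinfun_pow A n) sums L_exp (t *\<^sub>R A)"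
  unfolding sums_def by (rule tendsto_uniform_limitI[OF uniform_limit_L_exp[where R = "\<bar>t\<bar>"]]) simp

lemma L_exp_zero [simp]: "L_exp (0 :: 'y::complex_banach \<Rightarrow>\<^sub>L 'y) = id_blinfun"
proof -
  have "(\<lambda>n. (0::real) ^ n *\<^sub>R (1 / fact n) *\<^sub>R blinfun_pow (0 :: 'y \<Rightarrow>\<^sub>L 'y) n)
      = (\<lambda>n. if n = 0 then id_blinfun else 0)"
    by auto
  moreover have "(\<lambda>n. if n = 0 then id_blinfun else 0) sums (id_blinfun :: 'y \<Rightarrow>\<^sub>L 'y)"
    by (rule sums_single)
  moreover have "(\<lambda>n. (0::real) ^ n *\<^sub>R (1 / fact n) *\<^sub>R blinfun_pow (0 :: 'y \<Rightarrow>\<^sub>L 'y) n) sums L_exp 0"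
    using L_exp_sums[of 0 "0 :: 'y \<Rightarrow>\<^sub>L 'y"] by (simp only: scaleR_zero_left)
  ultimately show ?thesis by (simp only: sums_unique2)
qed

text \<open>The coefficients satisfy (n + 1) c(n + 1) = A c(n), so a differentiated partial sum is
  \<open>A\<close> composed with a partial sum of the original series. Uniform convergence of the
  derivatives is thus inherited from \<open>uniform_limit_L_exp\<close>.\<close>

lemma L_exp_vector_derivative:
  "((\<lambda>t. L_exp (t *\<^sub>R A)) has_vector_derivative (A o\<^sub>L L_exp (t *\<^sub>R A))) (at t)"
proof -
  define c where "c = (\<lambda>n. (1 / fact n) *\<^sub>R blinfun_pow A n)"
  define S where "S = ball (0::real) (\<bar>t\<bar> + 1)"
  have t: "t \<in> S" and oS: "open S" by (auto simp: S_def)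
  have csuc: "real (Suc n) *\<^sub>R c (Suc n) = A o\<^sub>L c n" for n
    by (simp add: c_def blinfun_compose_scaleR_right del: of_nat_Suc)
  \<comment> \<open>The truncated exponent \<open>n - 1\<close> is harmless at \<open>n = 0\<close>,
    where the factor \<open>real n\<close> vanishes.\<close>
  define f' where "f' = (\<lambda>n x h. (h * (real n * x ^ (n - 1))) *\<^sub>R c n)"
  have part: "(\<Sum>i<Suc n. f' i x h) = h *\<^sub>R (A o\<^sub>L (\<Sum>i<n. x ^ i *\<^sub>R c i))" for n x h
  proof -
    have "f' (Suc i) x h = h *\<^sub>R (A o\<^sub>L (x ^ i *\<^sub>R c i))" for i
    proof -
      have "f' (Suc i) x h = (h * x ^ i) *\<^sub>R real (Suc i) *\<^sub>R c (Suc i)"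
        by (simp add: f'_def mult_ac)
      then show ?thesis by (simp only: csuc blinfun_compose_scaleR_right scaleR_scaleR)
    qed
    moreover have "f' 0 x h = 0" by (simp add: f'_def)
    ultimately show ?thesis
      by (simp only: sum.lessThan_Suc_shift bounded_bilinear.sum_right[OF bounded_bilinear_blinfun_compose]
          scaleR_sum_right add_0)
  qed
  have "\<exists>g. \<forall>x\<in>S. (\<lambda>n. x ^ n *\<^sub>R c n) sums g x \<and>
      (g has_derivative (\<lambda>h. h *\<^sub>R (A o\<^sub>L L_exp (x *\<^sub>R A)))) (at x within S)"
  proof (rule has_derivative_series[where f' = f'])
    show "convex S" by (simp add: S_def)
    show "((\<lambda>x. x ^ n *\<^sub>R c n) has_derivative f' n x) (at x within S)" for n x
      unfolding f'_def by (auto intro!: derivative_eq_intros)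
    show "(\<lambda>n. t ^ n *\<^sub>R c n) sums L_exp (t *\<^sub>R A)"
      using L_exp_sums by (simp add: c_def)
    show "\<forall>\<^sub>F n in sequentially. \<forall>x\<in>S. \<forall>h.
        norm ((\<Sum>i<n. f' i x h) - h *\<^sub>R (A o\<^sub>L L_exp (x *\<^sub>R A))) \<le> e * norm h" if "e > 0" for e
    proof -
      define Q where "Q n \<longleftrightarrow> (\<forall>x\<in>S. \<forall>h.
        norm ((\<Sum>i<n. f' i x h) - h *\<^sub>R (A o\<^sub>L L_exp (x *\<^sub>R A))) \<le> e * norm h)" for n
      \<comment> \<open>The tolerance is divided by \<open>norm A + 1\<close> because composing with
        \<open>A\<close> costs a factor \<open>norm A\<close>; the added 1 keeps the denominator
        positive when \<open>A = 0\<close>.\<close>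
      have "\<forall>\<^sub>F n in sequentially. \<forall>x\<in>cball 0 (\<bar>t\<bar> + 1).
          dist (\<Sum>i<n. x ^ i *\<^sub>R c i) (L_exp (x *\<^sub>R A)) < e / (norm A + 1)"
        using uniform_limitD[OF uniform_limit_L_exp[where R = "\<bar>t\<bar> + 1" and A = A], of "e / (norm A + 1)"] that
        by (simp add: c_def add_nonneg_pos)
      then have "\<forall>\<^sub>F n in sequentially. \<forall>x\<in>S. \<forall>h.
        norm ((\<Sum>i<Suc n. f' i x h) - h *\<^sub>R (A o\<^sub>L L_exp (x *\<^sub>R A))) \<le> e * norm h"
      proof (eventually_elim, intro ballI allI)
        fix n x h
        assume *: "\<forall>x\<in>cball 0 (\<bar>t\<bar> + 1). dist (\<Sum>i<n. x ^ i *\<^sub>R c i) (L_exp (x *\<^sub>R A)) < e / (norm A + 1)"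
          and x: "x \<in> S"
        let ?D = "(\<Sum>i<n. x ^ i *\<^sub>R c i) - L_exp (x *\<^sub>R A)"
        have "norm ?D \<le> e / (norm A + 1)"
          using * x by (auto simp: S_def dist_norm intro!: less_imp_le)
        then have "norm (A o\<^sub>L ?D) \<le> norm A * (e / (norm A + 1))"
          by (rule order_trans[OF norm_blinfun_compose mult_left_mono[OF _ norm_ge_zero]])
        also have "\<dots> \<le> e" using that by (simp add: divide_le_eq add_nonneg_pos distrib_left)
        finally have "norm (h *\<^sub>R (A o\<^sub>L ?D)) \<le> e * norm h"
          by (simp only: norm_scaleR real_norm_def mult.commute[of e] mult_left_mono[OF _ abs_ge_zero])
        then show "norm ((\<Sum>i<Suc n. f' i x h) - h *\<^sub>R (A o\<^sub>L L_exp (x *\<^sub>R A))) \<le> e * norm h"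
          unfolding part
          by (simp only: bounded_bilinear.diff_right[OF bounded_bilinear_blinfun_compose] scaleR_diff_right)
      qed
      then have "\<forall>\<^sub>F n in sequentially. Q (Suc n)" unfolding Q_def .
      \<comment> \<open>Differentiation kills the constant term, so \<open>part\<close> describes
        sums of \<open>Suc n\<close> terms; the shift of index is undone here.\<close>
      then have "\<forall>\<^sub>F n in sequentially. Q n"
        by (rule eventually_sequentially_Suc[THEN iffD1, of Q])
      then show ?thesis unfolding Q_def .
    qed
  qed (use t in auto)
  then obtain g where g: "\<And>x. x \<in> S \<Longrightarrow> (\<lambda>n. x ^ n *\<^sub>R c n) sums g x"
      "\<And>x. x \<in> S \<Longrightarrow> (g has_derivative (\<lambda>h. h *\<^sub>R (A o\<^sub>L L_exp (x *\<^sub>R A)))) (at x within S)"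
    by blast
  have "g x = L_exp (x *\<^sub>R A)" if "x \<in> S" for x
    using g(1)[OF that] L_exp_sums[of x A] by (simp add: c_def sums_unique2)
  moreover have "(g has_derivative (\<lambda>h. h *\<^sub>R (A o\<^sub>L L_exp (t *\<^sub>R A)))) (at t)"
    using g(2)[OF t] by (simp only: at_within_open[OF t oS])
  ultimately have "((\<lambda>x. L_exp (x *\<^sub>R A)) has_derivative (\<lambda>h. h *\<^sub>R (A o\<^sub>L L_exp (t *\<^sub>R A)))) (at t)"
    by (elim has_derivative_transform_within_open[OF _ oS t]) simp
  then show ?thesis by (simp add: has_vector_derivative_def)
qed

section \<open>Commutation and the addition law for exponentials\<close>

lemma L_exp_commute:
  assumes "A o\<^sub>L S = S o\<^sub>L A"
  shows "L_exp A o\<^sub>L S = S o\<^sub>L L_exp A"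
proof -
  have pow: "blinfun_pow A n o\<^sub>L S = S o\<^sub>L blinfun_pow A n" for n
  proof (induction n)
    case (Suc n)
    have "blinfun_pow A (Suc n) o\<^sub>L S = A o\<^sub>L (blinfun_pow A n o\<^sub>L S)"
      by (simp add: blinfun_compose_assoc)
    also have "\<dots> = (A o\<^sub>L S) o\<^sub>L blinfun_pow A n" by (simp only: Suc blinfun_compose_assoc)
    also have "\<dots> = S o\<^sub>L blinfun_pow A (Suc n)" by (simp add: assms blinfun_compose_assoc)
    finally show ?case .
  qed simp
  have s: "(\<lambda>n. (1 / fact n) *\<^sub>R blinfun_pow A n) sums L_exp A"
    using L_exp_sums[of 1 A] by simp
  \<comment> \<open>Composition with \<open>S\<close> on either side is bounded linear, so it passes
    through the series, and the two resulting series agree term by term.\<close>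
  have "(\<lambda>n. ((1 / fact n) *\<^sub>R blinfun_pow A n) o\<^sub>L S) sums (L_exp A o\<^sub>L S)"
    by (rule bounded_linear.sums[OF bounded_bilinear.bounded_linear_left[OF bounded_bilinear_blinfun_compose] s])
  moreover have "(\<lambda>n. S o\<^sub>L ((1 / fact n) *\<^sub>R blinfun_pow A n)) sums (S o\<^sub>L L_exp A)"
    by (rule bounded_linear.sums[OF bounded_bilinear.bounded_linear_right[OF bounded_bilinear_blinfun_compose] s])
  ultimately show ?thesis
    by (simp add: blinfun_compose_scaleR_left blinfun_compose_scaleR_right pow sums_unique2)
qed

lemma has_vector_derivative_blinfun_compose:
  assumes "(F has_vector_derivative F') (at t)" "(G has_vector_derivative G') (at t)"
  shows "((\<lambda>t. F t o\<^sub>L G t) has_vector_derivative ((F t o\<^sub>L G') + (F' o\<^sub>L G t))) (at t)"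
  using bounded_bilinear.has_vector_derivative[OF bounded_bilinear_blinfun_compose assms] .

lemma zero_vector_derivative_imp_const:
  fixes f :: "real \<Rightarrow> 'a::real_normed_vector"
  assumes "\<And>t. (f has_vector_derivative 0) (at t)"
  shows "f t = f 0"
proof -
  have "\<exists>c. \<forall>x\<in>UNIV. f x = c"
    using assms by (intro has_derivative_zero_constant) (auto simp: has_vector_derivative_def)
  then show ?thesis by auto
qed

text \<open>The product e^(-tA) e^(tA) has derivative zero, since e^(-tA) commutes with
  \<open>A\<close> and the two terms of the product rule cancel. It therefore keeps its value at 0,
  the identity, up to t = 1.\<close>

lemma L_exp_minus_compose: "L_exp (- A) o\<^sub>L L_exp A = id_blinfun"
proof -
  let ?E = "\<lambda>t. L_exp (t *\<^sub>R A)" and ?F = "\<lambda>t. L_exp (t *\<^sub>R (- A))"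
  have "((\<lambda>t. ?F t o\<^sub>L ?E t) has_vector_derivative 0) (at t)" for t
  proof -
    have "((\<lambda>t. ?F t o\<^sub>L ?E t) has_vector_derivative
        ((?F t o\<^sub>L (A o\<^sub>L ?E t)) + (((- A) o\<^sub>L ?F t) o\<^sub>L ?E t))) (at t)"
      by (intro has_vector_derivative_blinfun_compose L_exp_vector_derivative)
    moreover have "?F t o\<^sub>L A = A o\<^sub>L ?F t"
      by (rule L_exp_commute) (simp add: blinfun_compose_scaleR_left blinfun_compose_scaleR_right
         bounded_bilinear.minus_left[OF bounded_bilinear_blinfun_compose]
         bounded_bilinear.minus_right[OF bounded_bilinear_blinfun_compose])
    then have "?F t o\<^sub>L (A o\<^sub>L ?E t) = (A o\<^sub>L ?F t) o\<^sub>L ?E t"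
      by (metis blinfun_compose_assoc)
    ultimately show ?thesis
      by (simp add: bounded_bilinear.minus_left[OF bounded_bilinear_blinfun_compose])
  qed
  from zero_vector_derivative_imp_const[of "\<lambda>t. ?F t o\<^sub>L ?E t" 1, OF this] show ?thesis by simp
qed

text \<open>The same device in place of a Cauchy product: e^(-t(A+B)) e^(tA) e^(tB) is constant
  because all factors commute with \<open>A\<close> and \<open>B\<close>. Multiplying its value at t
  = 1 on the left by e^(A+B) gives the claim.\<close>

lemma L_exp_add:
  assumes "A o\<^sub>L B = B o\<^sub>L A"
  shows "L_exp (A + B) = L_exp A o\<^sub>L L_exp B"
proof -
  note bil = bounded_bilinear_blinfun_compose
  let ?E = "\<lambda>A t. L_exp (t *\<^sub>R A)" and ?C = "- (A + B)"
  let ?G = "\<lambda>t. (?E ?C t o\<^sub>L ?E A t) o\<^sub>L ?E B t"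
  have com: "?E P t o\<^sub>L Q = Q o\<^sub>L ?E P t" if "P o\<^sub>L Q = Q o\<^sub>L P" for P Q t
    by (rule L_exp_commute) (simp add: that blinfun_compose_scaleR_left blinfun_compose_scaleR_right)
  have "(?G has_vector_derivative 0) (at t)" for t
  proof -
    have "(?G has_vector_derivative (((?E ?C t o\<^sub>L ?E A t) o\<^sub>L (B o\<^sub>L ?E B t)) +
        (((?E ?C t o\<^sub>L (A o\<^sub>L ?E A t)) + ((?C o\<^sub>L ?E ?C t) o\<^sub>L ?E A t)) o\<^sub>L ?E B t))) (at t)"
      by (intro has_vector_derivative_blinfun_compose L_exp_vector_derivative)
    moreover have "(?E ?C t o\<^sub>L ?E A t) o\<^sub>L (B o\<^sub>L ?E B t) = B o\<^sub>L ?G t"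
    proof -
      have "?C o\<^sub>L B = B o\<^sub>L ?C"
        by (simp add: bounded_bilinear.add_left[OF bil] bounded_bilinear.add_right[OF bil]
            bounded_bilinear.diff_left[OF bil] bounded_bilinear.diff_right[OF bil]
            bounded_bilinear.minus_left[OF bil] bounded_bilinear.minus_right[OF bil] assms)
      then show ?thesis using com[OF assms, of t] com[of ?C B t] by (metis blinfun_compose_assoc)
    qed
    moreover have "(?E ?C t o\<^sub>L (A o\<^sub>L ?E A t)) o\<^sub>L ?E B t = A o\<^sub>L ?G t"
    proof -
      have "?C o\<^sub>L A = A o\<^sub>L ?C"
        by (simp add: bounded_bilinear.add_left[OF bil] bounded_bilinear.add_right[OF bil]
            bounded_bilinear.diff_left[OF bil] bounded_bilinear.diff_right[OF bil]
            bounded_bilinear.minus_left[OF bil] bounded_bilinear.minus_right[OF bil] assms)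
      then show ?thesis using com[of ?C A t] by (metis blinfun_compose_assoc)
    qed
    moreover have "((?C o\<^sub>L ?E ?C t) o\<^sub>L ?E A t) o\<^sub>L ?E B t = ?C o\<^sub>L ?G t"
      by (simp only: blinfun_compose_assoc)
    ultimately show ?thesis
      by (simp add: bounded_bilinear.add_left[OF bil] bounded_bilinear.minus_left[OF bil]
          bounded_bilinear.diff_left[OF bil] blinfun_compose_assoc)
  qed
  from zero_vector_derivative_imp_const[of ?G 1, OF this]
  have 1: "(L_exp ?C o\<^sub>L L_exp A) o\<^sub>L L_exp B = id_blinfun" by simp
  have 2: "L_exp (A + B) o\<^sub>L L_exp ?C = id_blinfun"
    using L_exp_minus_compose[of "?C"] by (simp only: minus_minus)
  show ?thesis
    using arg_cong[OF 1, of "\<lambda>T. L_exp (A + B) o\<^sub>L T"] 2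
    by (metis blinfun_compose_assoc blinfun_compose_id)
qed

section \<open>Norming functionals and accretive operators\<close>

text \<open>Positive homogeneity is asked only as an inequality, which is easier to check for
  infima; equality follows by applying it to the inverse scalar, as in
  \<open>sublinear_scaleR\<close>.\<close>

definition sublinear :: "('a::real_vector \<Rightarrow> real) \<Rightarrow> bool" where
  "sublinear f \<longleftrightarrow> (\<forall>x y. f (x + y) \<le> f x + f y) \<and> (\<forall>c>0. \<forall>x. f (c *\<^sub>R x) \<le> c * f x)"

lemma sublinear_add: "sublinear f \<Longrightarrow> f (x + y) \<le> f x + f y"
  by (simp add: sublinear_def)

lemma sublinear_0:
  assumes "sublinear f"
  shows "f 0 = 0"
proof -
  have "f (c *\<^sub>R 0) \<le> c * f 0" if "c > 0" for c
    using assms that unfolding sublinear_def by blast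
  from this[of 2] this[of "1/2"] show ?thesis by simp
qed

lemma sublinear_scaleR:
  assumes "sublinear f" "0 \<le> c"
  shows "f (c *\<^sub>R x) = c * f x"
proof (cases "c = 0")
  case False
  with assms have c: "c > 0" by simp
  have "f (inverse c *\<^sub>R c *\<^sub>R x) \<le> inverse c * f (c *\<^sub>R x)"
    using assms(1) c unfolding sublinear_def by (meson positive_imp_inverse_positive)
  then have "c * f x \<le> f (c *\<^sub>R x)" using c by (simp add: field_simps)
  moreover have "f (c *\<^sub>R x) \<le> c * f x" using assms(1) c by (simp add: sublinear_def)
  ultimately show ?thesis by simp
qed (simp add: sublinear_0[OF assms(1)])

lemma sublinear_minus_le: "sublinear f \<Longrightarrow> - f (- x) \<le> f x"
  using sublinear_add[of f x "- x"] sublinear_0[of f] by simp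

text \<open>The functional is q(x) = inf over t >= 0 of f(x + tv) - t f(v). Subadditivity bounds the
  infimum below by -f(-x), t = 0 gives q <= f, and t = 1 at x = -v gives the last property. A linear
  functional below \<open>q\<close> is thereby forced to agree with \<open>f\<close> at
  \<open>v\<close>.\<close>

lemma sublinear_lower:
  assumes f: "sublinear f"
  obtains q where "sublinear q" "\<And>x. q x \<le> f x" "q (- v) \<le> - f v"
proof -
  define g where "g = (\<lambda>x t. f (x + t *\<^sub>R v) - t * f v)"
  define q where "q = (\<lambda>x. INF t\<in>{0..}. g x t)"
  have g_ge: "- f (- x) \<le> g x t" if "0 \<le> t" for x t
    using sublinear_add[OF f, of "x + t *\<^sub>R v" "- x"] sublinear_scaleR[OF f that, of v]
    by (simp add: g_def)
  have bdd: "bdd_below (g x ` {0..})" for x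
    using g_ge by (intro bdd_belowI[of _ "- f (- x)"]) auto
  have q_le: "q x \<le> g x t" if "0 \<le> t" for x t
    unfolding q_def using that by (intro cINF_lower[OF bdd]) auto
  have q_ge: "m \<le> q x" if "\<And>t. 0 \<le> t \<Longrightarrow> m \<le> g x t" for m x
    unfolding q_def using that by (intro cINF_greatest) auto
  have "q (x + y) \<le> q x + q y" for x y
  proof -
    have 1: "q (x + y) \<le> g x s + g y t" if "0 \<le> s" "0 \<le> t" for s t
    proof -
      have "q (x + y) \<le> g (x + y) (s + t)" using that by (intro q_le) simp
      also have "\<dots> \<le> g x s + g y t"
        using sublinear_add[OF f, of "x + s *\<^sub>R v" "y + t *\<^sub>R v"]
        by (simp add: g_def algebra_simps)
      finally show ?thesis .
    qed
    have "q (x + y) - g y t \<le> q x" if "0 \<le> t" for t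
      using 1 that by (intro q_ge) (simp add: algebra_simps)
    then have "q (x + y) - q x \<le> q y"
      by (intro q_ge) (simp add: algebra_simps)
    then show ?thesis by simp
  qed
  moreover have "q (c *\<^sub>R x) \<le> c * q x" if "0 < c" for c x
  proof -
    have "q (c *\<^sub>R x) / c \<le> q x"
    proof (rule q_ge)
      fix t :: real assume t: "0 \<le> t"
      have "q (c *\<^sub>R x) \<le> g (c *\<^sub>R x) (c * t)" using that t by (intro q_le) simp
      also have "\<dots> = c * g x t"
        using sublinear_scaleR[OF f less_imp_le[OF that], of "x + t *\<^sub>R v"]
        by (simp add: g_def algebra_simps)
      finally show "q (c *\<^sub>R x) / c \<le> g x t" using that by (simp add: field_simps)
    qed
    then show ?thesis using that by (simp add: field_simps)
  qed
  ultimately have "sublinear q" by (simp add: sublinear_def)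
  moreover have "q x \<le> f x" for x using q_le[of 0 x] by (simp add: g_def)
  moreover have "q (- v) \<le> - f v" using q_le[of 1 "- v"] by (simp add: g_def sublinear_0[OF f])
  ultimately show thesis by (rule that)
qed

text \<open>An infimum of sublinear functionals need not be subadditive; in a chain it is, because
  the smaller of \<open>f\<close> and \<open>g\<close> can serve for both summands.\<close>

lemma sublinear_INF:
  fixes F :: "('a::real_vector \<Rightarrow> real) set"
  assumes ne: "F \<noteq> {}" and sub: "\<And>f. f \<in> F \<Longrightarrow> sublinear f"
    and chain: "\<And>f g. f \<in> F \<Longrightarrow> g \<in> F \<Longrightarrow> (\<forall>x. f x \<le> g x) \<or> (\<forall>x. g x \<le> f x)"
    and bdd: "\<And>x. bdd_below ((\<lambda>f. f x) ` F)"
  shows "sublinear (\<lambda>x. INF f\<in>F. f x)"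
proof -
  let ?u = "\<lambda>x. INF f\<in>F. f x"
  have le: "?u x \<le> f x" if "f \<in> F" for f x
    using that by (intro cINF_lower[OF bdd]) auto
  have ge: "m \<le> ?u x" if "\<And>f. f \<in> F \<Longrightarrow> m \<le> f x" for m x
    using that ne by (intro cINF_greatest) auto
  have "?u (x + y) \<le> ?u x + ?u y" for x y
  proof -
    have 1: "?u (x + y) \<le> f x + g y" if "f \<in> F" "g \<in> F" for f g
      using chain[OF that]
    proof
      assume "\<forall>x. f x \<le> g x"
      then show ?thesis
        using le[OF that(1), of "x + y"] sublinear_add[OF sub[OF that(1)], of x y]
        by (meson add_left_mono order_trans)
    next
      assume "\<forall>x. g x \<le> f x"
      then show ?thesis
        using le[OF that(2), of "x + y"] sublinear_add[OF sub[OF that(2)], of x y]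
        by (meson add_right_mono order_trans)
    qed
    have "?u (x + y) - g y \<le> ?u x" if "g \<in> F" for g
      using 1 that by (intro ge) (simp add: algebra_simps)
    then have "?u (x + y) - ?u x \<le> ?u y"
      by (intro ge) (simp add: algebra_simps)
    then show ?thesis by simp
  qed
  moreover have "?u (c *\<^sub>R x) \<le> c * ?u x" if "0 < c" for c x
  proof -
    have "?u (c *\<^sub>R x) / c \<le> ?u x"
    proof (rule ge)
      fix f assume f: "f \<in> F"
      show "?u (c *\<^sub>R x) / c \<le> f x"
        using le[OF f, of "c *\<^sub>R x"] sublinear_scaleR[OF sub[OF f] less_imp_le[OF that], of x] that
        by (simp add: field_simps)
    qed
    then show ?thesis using that by (simp add: field_simps)
  qed
  ultimately show ?thesis by (simp add: sublinear_def)
qed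

text \<open>A minimal sublinear functional is linear: otherwise it could be lowered by
  \<open>sublinear_lower\<close>.\<close>

theorem hahn_banach_sublinear:
  fixes n :: "'a::real_vector \<Rightarrow> real"
  assumes n: "sublinear n"
  obtains f where "linear f" "\<And>x. f x \<le> n x"
proof -
  define A where "A = {f. sublinear f \<and> (\<forall>x. f x \<le> n x)}"
  \<comment> \<open>The order is reversed, so that the maximal element provided by Zorn's lemma is a
    minimal functional.\<close>
  define P where "P = (\<lambda>f g :: 'a \<Rightarrow> real. \<forall>x. g x \<le> f x)"
  have "\<exists>m\<in>A. \<forall>a\<in>A. P m a \<longrightarrow> a = m"
  proof (rule predicate_Zorn)
    show "partial_order_on A (relation_of P A)"
    proof (rule partial_order_on_relation_ofI)
      show "P f g \<Longrightarrow> P g k \<Longrightarrow> P f k" for f g k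
        unfolding P_def by (meson order_trans)
      show "P f g \<Longrightarrow> P g f \<Longrightarrow> f = g" for f g
        unfolding P_def by (simp add: fun_eq_iff antisym)
    qed (simp add: P_def)
    fix C assume C: "C \<in> Chains (relation_of P A)"
    then have ch: "P f g \<or> P g f" if "f \<in> C" "g \<in> C" for f g
      using that by (auto simp: Chains_def relation_of_def)
    have CA: "C \<subseteq> A"
      using C by (auto simp: Chains_def relation_of_def)
    show "\<exists>u\<in>A. \<forall>a\<in>C. P a u"
    proof (cases "C = {}")
      case True
      then show ?thesis using n by (auto simp: A_def)
    next
      case False
      let ?u = "\<lambda>x. INF f\<in>C. f x"
      have bdd: "bdd_below ((\<lambda>f. f x) ` C)" for x
      \<comment> \<open>All members of the chain lie below \<open>n\<close>, so evaluating at
        \<open>- x\<close> bounds them from below by one common real number.\<close>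
      proof (intro bdd_belowI[of _ "- n (- x)"], clarify)
        fix f assume "f \<in> C"
        then have "sublinear f" "f (- x) \<le> n (- x)" using CA by (auto simp: A_def)
        then show "- n (- x) \<le> f x" using sublinear_minus_le[of f x] by linarith
      qed
      have "sublinear ?u"
        using False CA ch bdd by (intro sublinear_INF) (auto simp: A_def P_def)
      moreover have le: "?u x \<le> f x" if "f \<in> C" for f x
        using that by (intro cINF_lower[OF bdd]) auto
      moreover have "?u x \<le> n x" for x
      proof -
        obtain f where "f \<in> C" using False by blast
        moreover from this have "f x \<le> n x" using CA by (auto simp: A_def)
        ultimately show ?thesis using le[of f x] by linarith
      qed
      ultimately show ?thesis by (intro bexI[of _ ?u]) (auto simp: A_def P_def)
    qed
  qed
  then obtain f where fA: "f \<in> A" and max: "\<And>g. g \<in> A \<Longrightarrow> P f g \<Longrightarrow> g = f"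
    by blast
  from fA have f: "sublinear f" "\<And>x. f x \<le> n x" by (auto simp: A_def)
  have min: "g = f" if g: "sublinear g" "\<And>x. g x \<le> f x" for g
  proof (rule max)
    show "g \<in> A" unfolding A_def using g f(2) by (blast intro: order_trans)
    show "P f g" using g(2) by (simp add: P_def)
  qed
  have neg: "f (- v) = - f v" for v
  proof (rule antisym)
    obtain q where "sublinear q" "\<And>x. q x \<le> f x" "q (- v) \<le> - f v"
      using sublinear_lower[OF f(1)] by metis
    with min[of q] show "f (- v) \<le> - f v" by simp
    show "- f v \<le> f (- v)" using sublinear_minus_le[OF f(1), of "- v"] by simp
  qed
  have "linear f"
  proof (rule linearI)
    fix x y
    \<comment> \<open>Oddness turns subadditivity at the negatives into the reverse inequality at
      \<open>x\<close> and \<open>y\<close>.\<close>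
    have "f (- x + - y) \<le> f (- x) + f (- y)" by (rule sublinear_add[OF f(1)])
    moreover have "- x + - y = - (x + y)" by simp
    ultimately have "- f (x + y) \<le> - f x - f y" by (simp only: neg)
    with sublinear_add[OF f(1), of x y] show "f (x + y) = f x + f y" by simp
  next
    fix c x
    show "f (c *\<^sub>R x) = c *\<^sub>R f x"
    proof (cases "0 \<le> c")
      case False
      then show ?thesis using sublinear_scaleR[OF f(1), of "- c" x] neg[of "c *\<^sub>R x"] by simp
    qed (simp add: sublinear_scaleR[OF f(1)])
  qed
  then show thesis using f(2) by (rule that)
qed

section \<open>Norming functionals, real and complex\<close>

lemma norming_functional_real:
  fixes v :: "'a::real_normed_vector"
  obtains f where "linear f" "\<And>x. f x \<le> norm x" "f v = norm v"
proof -
  have "sublinear (norm :: 'a \<Rightarrow> real)" by (simp add: sublinear_def norm_triangle_ineq)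
  \<comment> \<open>The norm is lowered at \<open>v\<close> before Hahn-Banach is applied; the value
    at \<open>v\<close> is then prescribed by domination alone, with no extension from the line
    through \<open>v\<close>.\<close>
  then obtain q :: "'a \<Rightarrow> real" where q: "sublinear q" "\<And>x. q x \<le> norm x" "q (- v) \<le> - norm v"
    using sublinear_lower by blast
  obtain f where f: "linear f" "\<And>x. f x \<le> q x"
    using hahn_banach_sublinear[OF q(1)] by blast
  have le: "f x \<le> norm x" for x using f(2)[of x] q(2)[of x] by simp
  have "f (- v) \<le> - norm v" using f(2)[of "- v"] q(3) by simp
  then have "f v = norm v" using le[of v] by (simp add: linear_neg[OF f(1)])
  with f(1) le show thesis by (rule that)
qed

lemma scaleC_one [simp]: "1 *\<^sub>C (x::'a::complex_normed_vector) = x"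
  by (metis of_real_1 scaleR_one scaleR_scaleC)

text \<open>The usual complexification l(x) = f(x) - i f(ix) of a real norming functional, whose
  real part is \<open>f\<close>.\<close>

lemma norming_functional_complex:
  fixes v :: "'a::complex_normed_vector"
  assumes v: "norm v = 1"
  obtains l :: "'a \<Rightarrow>\<^sub>L complex"
  where "complex_linear (blinfun_apply l)" "norm l = 1" "blinfun_apply l v = 1"
proof -
  obtain f where f: "linear f" "\<And>x. f x \<le> norm x" "f v = norm v"
    using norming_functional_real by blast
  define l where "l = (\<lambda>x. Complex (f x) (- f (\<i> *\<^sub>C x)))"
  have l_add: "l (x + y) = l x + l y" for x y
    by (simp add: l_def scaleC_add_right linear_add[OF f(1)] complex_eq_iff)
  have l_scaleR: "l (r *\<^sub>R x) = r *\<^sub>R l x" for r x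
  proof -
    have "\<i> *\<^sub>C (r *\<^sub>R x) = r *\<^sub>R (\<i> *\<^sub>C x)"
      by (simp add: scaleR_scaleC scaleC_scaleC mult.commute)
    then show ?thesis
      by (simp add: l_def linear_scale[OF f(1)] complex_eq_iff)
  qed
  have "\<i> *\<^sub>C \<i> *\<^sub>C x = - x" for x :: 'a
    using scaleR_scaleC[of "-1" x] by (simp add: scaleC_scaleC)
  then have l_i: "l (\<i> *\<^sub>C x) = \<i> * l x" for x
    by (simp add: l_def linear_neg[OF f(1)] complex_eq_iff)
  have l_scaleC: "l (c *\<^sub>C x) = c * l x" for c x
  proof -
    have "c *\<^sub>C x = Re c *\<^sub>R x + Im c *\<^sub>R (\<i> *\<^sub>C x)"
      by (simp add: scaleR_scaleC scaleC_scaleC flip: scaleC_add_left)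
        (metis complex_eq mult.commute)
    then have "l (c *\<^sub>C x) = Re c *\<^sub>R l x + Im c *\<^sub>R (\<i> * l x)"
      by (simp only: l_add l_scaleR l_i)
    then show ?thesis by (simp add: complex_eq_iff)
  qed
  have l_le: "norm (l x) \<le> norm x" for x
  proof (cases "l x = 0")
    case False
    \<comment> \<open>This unimodular factor rotates \<open>l x\<close> onto the positive real axis,
      where the modulus is a value of \<open>f\<close> at a vector of the same norm as
      \<open>x\<close>.\<close>
    define u where "u = cnj (l x) / norm (l x)"
    have u: "cmod u = 1" using False by (simp add: u_def norm_divide)
    have "u * l x = norm (l x)"
      using False by (simp add: u_def complex_norm_square[symmetric] power2_eq_square mult.commute)
    then have "norm (l x) = Re (l (u *\<^sub>C x))" by (simp add: l_scaleC)
    also have "\<dots> = f (u *\<^sub>C x)" by (simp add: l_def)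
    also have "\<dots> \<le> norm x" using f(2)[of "u *\<^sub>C x"] by (simp add: norm_scaleC u)
    finally show ?thesis .
  qed simp
  have bl: "bounded_linear l"
    by (rule bounded_linear_intro[where K = 1]) (simp_all add: l_add l_scaleR l_le)
  have app: "blinfun_apply (Blinfun l) = l" by (rule bounded_linear_Blinfun_apply[OF bl])
  have Re: "Re (l v) = 1" by (simp add: l_def f(3) v)
  have lv: "l v = 1"
  proof -
    \<comment> \<open>Since the modulus of \<open>l v\<close> is at most 1 and its real part is
      already 1, the imaginary part must vanish.\<close>
    have "(Re (l v))\<^sup>2 + (Im (l v))\<^sup>2 \<le> 1"
      using l_le[of v] v by (simp add: cmod_def)
    then show ?thesis using Re by (simp add: complex_eq_iff)
  qed
  show thesis
  proof (rule that[of "Blinfun l"])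
    show "complex_linear (blinfun_apply (Blinfun l))"
      by (simp add: app complex_linear_def l_add l_scaleC scaleC_complex_def)
    show "blinfun_apply (Blinfun l) v = 1" by (simp add: app lv)
    have "norm (Blinfun l) \<le> 1" by (rule norm_blinfun_bound) (simp_all add: app l_le)
    moreover have "1 \<le> norm (Blinfun l)"
      using norm_blinfun[of "Blinfun l" v] by (simp add: app lv v)
    ultimately show "norm (Blinfun l) = 1" by simp
  qed
qed

section \<open>Accretive operators generate contractions\<close>

lemma accretive_norm_le:
  assumes B: "accretive B" and s: "0 \<le> s"
  shows "norm v \<le> norm (v + s *\<^sub>R blinfun_apply B v)"
proof (cases "v = 0")
  case False
  \<comment> \<open>Accretivity speaks of unit vectors, so \<open>v\<close> is normalised and the
    factor \<open>norm v\<close> restored at the end.\<close>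
  define y where "y = v /\<^sub>R norm v"
  have y: "norm y = 1" using False by (simp add: y_def)
  have v: "v = norm v *\<^sub>R y" using False by (simp add: y_def)
  obtain l :: "'a \<Rightarrow>\<^sub>L complex" where l: "complex_linear (blinfun_apply l)" "norm l = 1" "blinfun_apply l y = 1"
    using norming_functional_complex[OF y] by blast
  have Re: "0 \<le> Re (blinfun_apply l (blinfun_apply B y))"
    using B y l unfolding accretive_def by blast
  have "1 \<le> Re (blinfun_apply l (y + s *\<^sub>R blinfun_apply B y))"
    using Re s by (simp add: blinfun.add_right blinfun.scaleR_right l)
  also have "\<dots> \<le> norm (y + s *\<^sub>R blinfun_apply B y)"
    using complex_Re_le_cmod norm_blinfun[of l] l(2) by (metis mult_1 order_trans)
  finally have "norm v * 1 \<le> norm v * norm (y + s *\<^sub>R blinfun_apply B y)"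
    by (intro mult_left_mono) auto
  also have "\<dots> = norm (norm v *\<^sub>R (y + s *\<^sub>R blinfun_apply B y))" by simp
  also have "norm v *\<^sub>R (y + s *\<^sub>R blinfun_apply B y) = v + s *\<^sub>R blinfun_apply B v"
    using False by (simp add: y_def scaleR_add_right blinfun.scaleR_right)
  finally show ?thesis by simp
qed simp

lemma norm_L_exp_multiple: "norm (L_exp (real n *\<^sub>R A)) \<le> norm (L_exp A) ^ n"
proof (induction n)
  case 0
  show ?case by (simp add: norm_blinfun_id_le)
next
  case (Suc n)
  have "L_exp (real (Suc n) *\<^sub>R A) = L_exp A o\<^sub>L L_exp (real n *\<^sub>R A)"
    by (subst L_exp_add[symmetric])
      (simp_all add: blinfun_compose_scaleR_left blinfun_compose_scaleR_right scaleR_add_left)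
  also have "norm \<dots> \<le> norm (L_exp A) * norm (L_exp A) ^ n"
    by (rule order_trans[OF norm_blinfun_compose mult_left_mono[OF Suc.IH norm_ge_zero]])
  finally show ?case by simp
qed

text \<open>The derivative of (1 + sB) e^(-sB) at 0 is -B + B = 0, so this product is within
  \<open>e * s\<close> of the identity for small s >= 0. By \<open>accretive_norm_le\<close>,
  applied at e^(-sB) w, dropping the factor 1 + sB can only decrease the norm.\<close>

lemma norm_L_exp_accretive_near_0:
  assumes B: "accretive B" and e: "0 < e"
  obtains \<delta> where "0 < \<delta>" "\<And>s. 0 \<le> s \<Longrightarrow> s < \<delta> \<Longrightarrow> norm (L_exp (- (s *\<^sub>R B))) \<le> 1 + e * s"
proof -
  note bil = bounded_bilinear_blinfun_compose
  let ?E = "\<lambda>s. L_exp (s *\<^sub>R (- B))"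
  let ?F = "\<lambda>s. ?E s + s *\<^sub>R (B o\<^sub>L ?E s)"
  have "((\<lambda>s. B o\<^sub>L ?E s) has_vector_derivative (B o\<^sub>L (- B o\<^sub>L ?E 0))) (at 0)"
    by (rule bounded_linear.has_vector_derivative[OF bounded_bilinear.bounded_linear_right[OF bil]
          L_exp_vector_derivative])
  then have "(?F has_vector_derivative
      (- B o\<^sub>L ?E 0) + (0 *\<^sub>R (B o\<^sub>L (- B o\<^sub>L ?E 0)) + 1 *\<^sub>R (B o\<^sub>L ?E 0))) (at 0)"
    by (intro has_vector_derivative_add L_exp_vector_derivative has_vector_derivative_scaleR DERIV_ident)
  then have "(?F has_vector_derivative 0) (at 0)" by simp
  then have "(?F has_derivative (\<lambda>h. 0)) (at 0)" by (simp add: has_vector_derivative_def)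
  then obtain \<delta> where \<delta>: "0 < \<delta>"
    "\<And>s. \<bar>s\<bar> < \<delta> \<Longrightarrow> norm (?F s - id_blinfun) \<le> e * \<bar>s\<bar>"
    using e unfolding has_derivative_at_alt by auto
  show thesis
  proof (rule that[OF \<delta>(1)])
    fix s :: real assume s: "0 \<le> s" "s < \<delta>"
    have F: "norm (?F s) \<le> 1 + e * s"
      using norm_triangle_ineq[of "?F s - id_blinfun" id_blinfun] \<delta>(2)[of s] s norm_blinfun_id_le[where 'a = 'a]
      by simp
    show "norm (L_exp (- (s *\<^sub>R B))) \<le> 1 + e * s"
    proof (rule norm_blinfun_bound)
      fix w
      have "norm (blinfun_apply (?E s) w) \<le> norm (blinfun_apply (?F s) w)"
        using accretive_norm_le[OF B s(1), of "blinfun_apply (?E s) w"]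
        by (simp add: blinfun.add_left blinfun.scaleR_left)
      also have "\<dots> \<le> (1 + e * s) * norm w"
        by (rule order_trans[OF norm_blinfun mult_right_mono[OF F norm_ge_zero]])
      finally show "norm (blinfun_apply (L_exp (- (s *\<^sub>R B))) w) \<le> (1 + e * s) * norm w" by simp
    qed (use e s in simp)
  qed
qed

text \<open>Splitting t into n steps of length s below \<delta> gives the bound (1 + es)^n <= exp (e
  t), which is independent of n; then e tends to 0.\<close>

theorem norm_L_exp_accretive:
  assumes B: "accretive B" and t: "0 \<le> t"
  shows "norm (L_exp (- (t *\<^sub>R B))) \<le> 1"
proof -
  let ?N = "norm (L_exp (- (t *\<^sub>R B)))"
  have "?N \<le> exp (e * t)" if e: "0 < e" for e
  proof -
    obtain \<delta> where \<delta>: "0 < \<delta>"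
      "\<And>s. 0 \<le> s \<Longrightarrow> s < \<delta> \<Longrightarrow> norm (L_exp (- (s *\<^sub>R B))) \<le> 1 + e * s"
      using norm_L_exp_accretive_near_0[OF B e] by blast
    obtain n where n: "t / \<delta> < real n" using reals_Archimedean2 by blast
    have n0: "0 < real n" using n t \<delta>(1) by (meson divide_nonneg_pos le_less_trans)
    define s where "s = t / real n"
    have s: "0 \<le> s" "s < \<delta>" using t n n0 \<delta>(1) by (auto simp: s_def field_simps)
    have "t = real n * s" using n0 by (simp add: s_def)
    then have "?N = norm (L_exp (real n *\<^sub>R (- (s *\<^sub>R B))))" by simp
    also have "\<dots> \<le> norm (L_exp (- (s *\<^sub>R B))) ^ n" by (rule norm_L_exp_multiple)
    also have "\<dots> \<le> exp (e * s) ^ n"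
      using order_trans[OF \<delta>(2)[OF s] exp_ge_add_one_self[of "e * s"]] by (intro power_mono) auto
    also have "\<dots> = exp (e * t)"
      using n0 by (simp add: s_def flip: exp_of_nat_mult)
    finally show ?thesis .
  qed
  then have "\<forall>\<^sub>F e in at_right 0. ?N \<le> exp (e * t)"
    by (auto simp: eventually_at_right_field intro: exI[of _ 1])
  moreover have "((\<lambda>e. exp (e * t)) \<longlongrightarrow> exp (0 * t)) (at_right 0)"
    by (intro tendsto_intros)
  ultimately have "?N \<le> exp (0 * t)"
    using tendsto_lowerbound trivial_limit_at_right_real by blast
  then show ?thesis by simp
qed

section \<open>The domain in the product space\<close>

lemma admissible_p_less:
  assumes "admissible_p p" "0 \<le> r" "r < s" "s \<le> 1"
  shows "p s < p r"
proof -
  have "strict_antimono_on {0..1} p" using assms(1) by (simp add: admissible_p_def)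
  from monotone_onD[OF this, of r s] show ?thesis using assms(2-4) by simp
qed

lemma admissible_p_antimono:
  assumes "admissible_p p" "0 \<le> r" "r \<le> s" "s \<le> 1"
  shows "p s \<le> p r"
proof (cases "r = s")
  case False
  then show ?thesis using admissible_p_less[of p r s] assms by simp
qed simp

lemma admissible_p_pos:
  assumes "admissible_p p" "0 \<le> r" "r < 1"
  shows "0 < p r"
proof -
  have "p 1 = 0" using assms(1) by (simp add: admissible_p_def)
  then show ?thesis using admissible_p_less[of p r 1] assms by simp
qed

text \<open>The values of \<open>p\<close> are at most \<open>p 0 = 1\<close>, so the inequality
  already places \<open>y\<close> in its unit ball.\<close>

lemma mem_DD_iff:
  assumes p: "admissible_p p"
  shows "(x, y) \<in> DD p \<longleftrightarrow> norm x < 1 \<and> norm y < p (norm x)"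
proof -
  have "p (norm x) \<le> 1" if "norm x < 1"
    using admissible_p_antimono[OF p, of 0 "norm x"] that p by (simp add: admissible_p_def)
  then show ?thesis by (auto simp: DD_def)
qed

text \<open>\<open>p\<close> is controlled on [0, 1] only. Truncating the norm at 1 makes the bound
  continuous on the whole space, and \<open>p 1 = 0\<close> makes the strict inequality fail outside
  the ball.\<close>

lemma open_DD:
  assumes p: "admissible_p p"
  shows "open (DD p :: ('x::complex_banach \<times> 'y::complex_banach) set)"
proof -
  have "(DD p :: ('x \<times> 'y) set) = {v. norm (snd v) < p (min 1 (norm (fst v)))}"
  proof (rule set_eqI)
    fix v :: "'x \<times> 'y"
    show "v \<in> DD p \<longleftrightarrow> v \<in> {v. norm (snd v) < p (min 1 (norm (fst v)))}"
      using p by (cases v) (auto simp: mem_DD_iff[OF p] admissible_p_def min_def)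
  qed
  moreover have "continuous_on UNIV (\<lambda>v::'x \<times> 'y. p (min 1 (norm (fst v))))"
  proof (rule continuous_on_compose2[where g = p])
    show "continuous_on {0..1} p" using p by (simp add: admissible_p_def)
    show "continuous_on UNIV (\<lambda>v::'x \<times> 'y. min 1 (norm (fst v)))" by (intro continuous_intros)
  qed auto
  ultimately show ?thesis
    by (simp only:) (intro open_Collect_less continuous_intros)
qed

text \<open>Shrinking a point lowers both norms, and as \<open>p\<close> decreases the bound on the
  second one only grows; so \<open>DD p\<close> is starlike about 0.\<close>

lemma scaleR_in_DD:
  assumes p: "admissible_p p" and v: "v \<in> DD p" and c: "0 \<le> c" "c \<le> 1"
  shows "c *\<^sub>R v \<in> DD p"
proof -
  obtain x y where xy: "v = (x, y)" "norm x < 1" "norm y < p (norm x)"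
    using v mem_DD_iff[OF p] by (cases v) auto
  have 1: "norm (c *\<^sub>R x) \<le> norm x" "norm (c *\<^sub>R y) \<le> norm y"
    using c by (auto intro: mult_left_le_one_le)
  then have "p (norm x) \<le> p (norm (c *\<^sub>R x))"
    using xy(2) by (intro admissible_p_antimono[OF p]) auto
  then show ?thesis using 1 xy by (simp add: mem_DD_iff[OF p])
qed

lemma connected_DD:
  assumes p: "admissible_p p"
  shows "connected (DD p :: ('x::complex_banach \<times> 'y::complex_banach) set)"
proof (rule starlike_imp_connected)
  have "closed_segment 0 v \<subseteq> DD p" if "v \<in> DD p" for v :: "'x \<times> 'y"
    using scaleR_in_DD[OF p that] by (auto simp: in_segment)
  moreover have "(0 :: 'x \<times> 'y) \<in> DD p"
    using p by (simp add: zero_prod_def mem_DD_iff admissible_p_def)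
  ultimately show "starlike (DD p :: ('x \<times> 'y) set)"
    unfolding starlike_def by blast
qed

text \<open>Positivity of \<open>p\<close> on [0, 1) puts (x, 0) / r in \<open>DD p\<close> exactly
  for r > 1. This supplies the normalisation of the direction in
  \<open>convex_in_direction\<close>.\<close>

lemma minkowski_functional_DD_horizontal:
  fixes x :: "'x::complex_banach"
  assumes p: "admissible_p p" and x: "norm x = 1"
  shows "minkowski_functional (DD p) (x, 0 :: 'y::complex_banach) = 1"
proof -
  define e where "e = (x, 0 :: 'y)"
  have "e \<in> (\<lambda>v. r *\<^sub>R v) ` DD p \<longleftrightarrow> 1 < r" if r: "0 < r" for r
  proof -
    have "e \<in> (\<lambda>v. r *\<^sub>R v) ` DD p \<longleftrightarrow> inverse r *\<^sub>R e \<in> DD p"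
    proof
      assume "e \<in> (\<lambda>v. r *\<^sub>R v) ` DD p"
      then show "inverse r *\<^sub>R e \<in> DD p" using r by auto
    next
      assume "inverse r *\<^sub>R e \<in> DD p"
      then show "e \<in> (\<lambda>v. r *\<^sub>R v) ` DD p"
        using r by (intro image_eqI[of _ _ "inverse r *\<^sub>R e"]) auto
    qed
    also have "\<dots> \<longleftrightarrow> 1 < r"
      using r x admissible_p_pos[OF p, of "inverse r"]
      by (auto simp: e_def mem_DD_iff[OF p] field_simps)
    finally show ?thesis .
  qed
  then have "{r. 0 < r \<and> e \<in> (\<lambda>v. r *\<^sub>R v) ` DD p} = {1<..}" by auto
  then show ?thesis by (simp add: minkowski_functional_def e_def)
qed

section \<open>Extension operators\<close>

text \<open>Rests on the identity S z - S x = S z (G x - G z) S x. With a, d, e the norms of S x, G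
  z - G x, S z - S x it gives e <= (a + e) d a; once d a < 1/2, the term in e is absorbed on the
  left and e <= 2 a a d.\<close>

lemma continuous_on_operator_inverse:
  fixes G S :: "'a::topological_space \<Rightarrow> ('y::real_normed_vector \<Rightarrow>\<^sub>L 'y)"
  assumes G: "continuous_on U G"
    and SG: "\<And>x. x \<in> U \<Longrightarrow> S x o\<^sub>L G x = id_blinfun"
    and GS: "\<And>x. x \<in> U \<Longrightarrow> G x o\<^sub>L S x = id_blinfun"
  shows "continuous_on U S"
  unfolding continuous_on_def
proof
  fix x assume x: "x \<in> U"
  define a where "a = norm (S x)"
  have Gx: "(G \<longlongrightarrow> G x) (at x within U)" using G x by (simp add: continuous_on_def)
  then have d0: "((\<lambda>z. norm (G z - G x)) \<longlongrightarrow> 0) (at x within U)"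
    by (simp add: LIM_zero tendsto_norm_zero)
  then have "((\<lambda>z. norm (G z - G x) * a) \<longlongrightarrow> 0 * a) (at x within U)"
    by (intro tendsto_intros)
  then have "\<forall>\<^sub>F z in at x within U. norm (G z - G x) * a < 1/2"
    by (rule order_tendstoD(2)) simp
  moreover have "\<forall>\<^sub>F z in at x within U. z \<in> U"
    by (simp add: eventually_at_topological) blast
  ultimately have "\<forall>\<^sub>F z in at x within U. norm (S z - S x) \<le> 2 * a * a * norm (G z - G x)"
  proof eventually_elim
    case (elim z)
    define d e where "d = norm (G z - G x)" and "e = norm (S z - S x)"
    have "S z - S x = S z o\<^sub>L ((G x - G z) o\<^sub>L S x)"
    proof (rule blinfun_eqI)
      fix y
      have "blinfun_apply (S z) (blinfun_apply (G x) (blinfun_apply (S x) y)) = blinfun_apply (S z) y"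
        using GS[OF x] by (metis blinfun_apply_blinfun_compose blinfun_apply_id_blinfun id_apply)
      moreover have "blinfun_apply (S z) (blinfun_apply (G z) (blinfun_apply (S x) y)) = blinfun_apply (S x) y"
        using SG[OF elim(2)] by (metis blinfun_apply_blinfun_compose blinfun_apply_id_blinfun id_apply)
      ultimately show "blinfun_apply (S z - S x) y = blinfun_apply (S z o\<^sub>L ((G x - G z) o\<^sub>L S x)) y"
        by (simp add: blinfun.diff_left blinfun.diff_right)
    qed
    then have "e \<le> norm (S z) * norm ((G x - G z) o\<^sub>L S x)"
      unfolding e_def by (metis norm_blinfun_compose)
    also have "\<dots> \<le> norm (S z) * (d * a)"
      unfolding d_def a_def
      unfolding norm_minus_commute[of "G z"] by (intro mult_left_mono norm_blinfun_compose norm_ge_zero)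
    also have "\<dots> \<le> (a + e) * (d * a)"
      using norm_triangle_ineq[of "S x" "S z - S x"]
      by (intro mult_right_mono) (auto simp: a_def e_def d_def)
    also have "\<dots> = a * (d * a) + e * (d * a)" by (simp add: distrib_right)
    also have "e * (d * a) \<le> e * (1/2)"
      using elim(1) by (intro mult_left_mono) (auto simp: d_def e_def)
    finally show ?case by (simp add: e_def d_def mult_ac)
  qed
  moreover have "((\<lambda>z. 2 * a * a * norm (G z - G x)) \<longlongrightarrow> 0) (at x within U)"
    using tendsto_mult_right_zero[OF d0] by simp
  ultimately have "((\<lambda>z. S z - S x) \<longlongrightarrow> 0) (at x within U)"
    by (rule Lim_null_comparison)
  then show "(S \<longlongrightarrow> S x) (at x within U)" by (rule LIM_zero_cancel)
qed

section \<open>Biholomorphy of fibrewise linear maps\<close>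

lemma holomorphic_map_on_imp_continuous_on:
  assumes "holomorphic_map_on f D"
  shows "continuous_on D f"
  using assms unfolding holomorphic_map_on_def continuous_on_eq_continuous_within
  by (meson continuous_at_imp_continuous_at_within has_derivative_continuous)

lemma holomorphic_map_onE:
  assumes "holomorphic_map_on f D" "x \<in> D"
  obtains f' where "complex_linear f'" "(f has_derivative f') (at x)"
  using assms unfolding holomorphic_map_on_def by blast

text \<open>The inverse sends (z, w) to (k z, S(k z) w) with k the inverse of \<open>h\<close> and S
  x that of \<open>G x\<close>. It suffices to know that S is continuous: differentiability of the
  inverse then follows from an explicit inverse of the derivative of \<Phi>.\<close>

theorem biholomorphic_on_fibre_linear:
  fixes h :: "'x::complex_banach \<Rightarrow> 'x" and G :: "'x \<Rightarrow> ('y::complex_banach \<Rightarrow>\<^sub>L 'y)"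
    and \<Phi> :: "'x \<times> 'y \<Rightarrow> 'x \<times> 'y"
  assumes D: "open D" "D \<subseteq> U \<times> UNIV"
    and h: "biholomorphic_on h U" and G: "holomorphic_map_on G U"
    and L: "\<And>x. x \<in> U \<Longrightarrow> G x \<in> L_ops" and inv: "\<And>x. x \<in> U \<Longrightarrow> L_invertible (G x)"
    and \<Phi>: "\<And>x y. (x, y) \<in> D \<Longrightarrow> \<Phi> (x, y) = (h x, blinfun_apply (G x) y)"
  shows "biholomorphic_on \<Phi> D"
proof -
  define k where "k = inv_into U h"
  define V where "V = h ` U"
  have inj: "inj_on h U" and hol_h: "holomorphic_map_on h U" and V: "open V"
    and hol_k: "holomorphic_map_on k V"
    using h by (auto simp: biholomorphic_on_def k_def V_def)
  have kh: "k (h x) = x" if "x \<in> U" for x using inj that by (simp add: k_def)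
  have hk: "h (k z) = z" "k z \<in> U" if "z \<in> V" for z
    using that by (auto simp: k_def V_def f_inv_into_f inv_into_into)
  have U: "open U" using hol_h by (simp add: holomorphic_map_on_def)
  obtain S where S: "\<And>x. x \<in> U \<Longrightarrow> S x \<in> L_ops" "\<And>x. x \<in> U \<Longrightarrow> S x o\<^sub>L G x = id_blinfun"
    "\<And>x. x \<in> U \<Longrightarrow> G x o\<^sub>L S x = id_blinfun"
    using inv unfolding L_invertible_def by metis
  have SG: "blinfun_apply (S x) (blinfun_apply (G x) y) = y" if "x \<in> U" for x y
    using S(2)[OF that] by (metis blinfun_apply_blinfun_compose blinfun_apply_id_blinfun id_apply)
  have GS: "blinfun_apply (G x) (blinfun_apply (S x) y) = y" if "x \<in> U" for x y
    using S(3)[OF that] by (metis blinfun_apply_blinfun_compose blinfun_apply_id_blinfun id_apply)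
  have linG: "blinfun_apply (G x) (c *\<^sub>C y) = c *\<^sub>C blinfun_apply (G x) y" if "x \<in> U" for x c y
    using L[OF that] by (simp add: L_ops_def complex_linear_def)
  have linS: "blinfun_apply (S x) (c *\<^sub>C y) = c *\<^sub>C blinfun_apply (S x) y" if "x \<in> U" for x c y
    using S(1)[OF that] by (simp add: L_ops_def complex_linear_def)
  define \<Psi> where "\<Psi> = (\<lambda>v. (k (fst v), blinfun_apply (S (k (fst v))) (snd v)))"
  have \<Psi>\<Phi>: "\<Psi> (\<Phi> v) = v" if "v \<in> D" for v
    using that D(2) \<Phi>[of "fst v" "snd v"] by (cases v) (auto simp: \<Psi>_def kh SG)
  have \<Phi>\<Psi>: "\<Phi> (\<Psi> v) = v" if "v \<in> \<Phi> ` D" for v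
    using that \<Psi>\<Phi> by auto
  have inj\<Phi>: "inj_on \<Phi> D" using \<Psi>\<Phi> by (metis inj_on_inverseI)
  have inv\<Phi>: "inv_into D \<Phi> v = \<Psi> v" if "v \<in> \<Phi> ` D" for v
    using that \<Psi>\<Phi> inj\<Phi> by auto
  have cont_S: "continuous_on U S"
    by (rule continuous_on_operator_inverse[OF holomorphic_map_on_imp_continuous_on[OF G]]) (use S in auto)
  have cont_k: "continuous_on V k" by (rule holomorphic_map_on_imp_continuous_on[OF hol_k])
  have cont_Sk: "continuous_on V (\<lambda>z. S (k z))"
    by (rule continuous_on_compose2[OF cont_S cont_k]) (use hk in auto)
  have cont_\<Psi>: "continuous_on (V \<times> UNIV) \<Psi>"
    unfolding \<Psi>_def
    by (intro continuous_on_Pair blinfun.continuous_on continuous_on_snd continuous_on_id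
        continuous_on_compose2[OF cont_k] continuous_on_compose2[OF cont_Sk] continuous_on_fst) auto
  have open_V: "open (V \<times> (UNIV :: 'y set))" using V by (simp add: open_Times)
  \<comment> \<open>Describing the image as a preimage of \<open>D\<close> under the continuous
    \<Psi> makes it open.\<close>
  have image: "\<Phi> ` D = (V \<times> UNIV) \<inter> \<Psi> -` D"
  proof (rule set_eqI)
    fix v
    show "v \<in> \<Phi> ` D \<longleftrightarrow> v \<in> (V \<times> UNIV) \<inter> \<Psi> -` D"
    proof
      assume "v \<in> \<Phi> ` D"
      then show "v \<in> (V \<times> UNIV) \<inter> \<Psi> -` D" using D(2) \<Phi> \<Psi>\<Phi> by (fastforce simp: V_def)
    next
      assume v: "v \<in> (V \<times> UNIV) \<inter> \<Psi> -` D"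
      then have "fst v \<in> V" by auto
      then have "\<Phi> (\<Psi> v) = v"
        using v \<Phi>[of "fst (\<Psi> v)" "snd (\<Psi> v)"] by (simp add: \<Psi>_def hk GS)
      then show "v \<in> \<Phi> ` D" using v by (metis IntD2 imageI vimageE)
    qed
  qed
  then have open_image: "open (\<Phi> ` D)"
    using continuous_open_preimage[OF cont_\<Psi> open_V D(1)] by simp
  \<comment> \<open>The derivative is block triangular: its first component depends on
    \<open>u\<close> only, which makes it easy to invert.\<close>
  have deriv: "\<exists>h' G'. complex_linear h' \<and> (h has_derivative h') (at x) \<and> complex_linear G' \<and> bounded_linear G' \<and>
      (\<Phi> has_derivative (\<lambda>(u, v). (h' u, blinfun_apply (G' u) y + blinfun_apply (G x) v))) (at (x, y))"
    if xy: "(x, y) \<in> D" for x y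
  proof -
    have x: "x \<in> U" using xy D(2) by auto
    obtain h' where h': "complex_linear h'" "(h has_derivative h') (at x)"
      using holomorphic_map_onE[OF hol_h x] by blast
    obtain G' where G': "complex_linear G'" "(G has_derivative G') (at x)"
      using holomorphic_map_onE[OF G x] by blast
    have fst: "(fst has_derivative fst) (at (x, y))" and snd: "(snd has_derivative snd) (at (x, y))"
      by (auto intro!: derivative_eq_intros)
    have "((\<lambda>v. h (fst v)) has_derivative (\<lambda>v. h' (fst v))) (at (x, y))"
      by (rule has_derivative_compose[OF fst]) (simp add: h')
    moreover have "((\<lambda>v. G (fst v)) has_derivative (\<lambda>v. G' (fst v))) (at (x, y))"
      by (rule has_derivative_compose[OF fst]) (simp add: G')
    from bounded_bilinear.FDERIV[OF bounded_bilinear_blinfun_apply this snd]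
    have "((\<lambda>v. blinfun_apply (G (fst v)) (snd v)) has_derivative
        (\<lambda>v. blinfun_apply (G x) (snd v) + blinfun_apply (G' (fst v)) y)) (at (x, y))"
      by simp
    ultimately have "((\<lambda>v. (h (fst v), blinfun_apply (G (fst v)) (snd v))) has_derivative
        (\<lambda>v. (h' (fst v), blinfun_apply (G x) (snd v) + blinfun_apply (G' (fst v)) y))) (at (x, y))"
      by (rule has_derivative_Pair)
    then have "(\<Phi> has_derivative
        (\<lambda>v. (h' (fst v), blinfun_apply (G x) (snd v) + blinfun_apply (G' (fst v)) y))) (at (x, y))"
      by (rule has_derivative_transform_within_open[OF _ D(1) xy]) (use \<Phi> in auto)
    also have "(\<lambda>v. (h' (fst v), blinfun_apply (G x) (snd v) + blinfun_apply (G' (fst v)) y)) =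
        (\<lambda>(u, v). (h' u, blinfun_apply (G' u) y + blinfun_apply (G x) v))"
      by (auto simp: fun_eq_iff add.commute)
    finally show ?thesis using h' G' has_derivative_bounded_linear[OF G'(2)] by blast
  qed
  have hol_\<Phi>: "holomorphic_map_on \<Phi> D"
    unfolding holomorphic_map_on_def
  proof (intro conjI ballI)
    fix v assume v: "v \<in> D"
    obtain x y where xy: "v = (x, y)" by (cases v)
    with v D(2) have x: "x \<in> U" by auto
    obtain h' G' where 1: "complex_linear h'" "complex_linear G'"
      "(\<Phi> has_derivative (\<lambda>(u, v). (h' u, blinfun_apply (G' u) y + blinfun_apply (G x) v))) (at (x, y))"
      using deriv v xy by blast
    have "complex_linear (\<lambda>(u, v). (h' u, blinfun_apply (G' u) y + blinfun_apply (G x) v))"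
      using 1(1,2) unfolding complex_linear_def
      by (auto simp: scaleC_prod_def blinfun.add_left blinfun.add_right scaleC_blinfun.rep_eq
          linG[OF x] scaleC_add_right)
    then show "\<exists>A. complex_linear A \<and> (\<Phi> has_derivative A) (at v)" using 1(3) xy by blast
  qed (rule D(1))
  have "holomorphic_map_on (inv_into D \<Phi>) (\<Phi> ` D)"
    unfolding holomorphic_map_on_def
  proof (intro conjI ballI)
    fix v assume v: "v \<in> \<Phi> ` D"
    define x y where "x = fst (\<Psi> v)" and "y = snd (\<Psi> v)"
    have xy: "(x, y) \<in> D" "\<Psi> v = (x, y)" using v image by (auto simp: x_def y_def)
    then have x: "x \<in> U" using D(2) by auto
    have z: "fst v \<in> V" using v image by auto
    obtain h' G' where 1: "(h has_derivative h') (at x)" "complex_linear G'" and bl_G': "bounded_linear G'" and \<Phi>':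
      "(\<Phi> has_derivative (\<lambda>(u, v). (h' u, blinfun_apply (G' u) y + blinfun_apply (G x) v))) (at (x, y))"
      using deriv[OF xy(1)] by blast
    obtain k' where k': "complex_linear k'" "(k has_derivative k') (at (fst v))"
      using holomorphic_map_onE[OF hol_k z] by blast
    have hx: "h x = fst v" using hk[OF z] by (simp add: x_def \<Psi>_def)
    \<comment> \<open>Chain rule for the composition of k after h, which is the identity near
      \<open>x\<close>.\<close>
    have k'h': "k' (h' u) = u" for u
    proof -
      have "((\<lambda>x. k (h x)) has_derivative (\<lambda>u. k' (h' u))) (at x)"
        by (rule has_derivative_compose[OF 1(1)]) (simp add: hx k')
      then have "((\<lambda>x. x) has_derivative (\<lambda>u. k' (h' u))) (at x)"
        by (rule has_derivative_transform_within_open[OF _ U x]) (simp add: kh)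
      then show ?thesis
        using has_derivative_unique[OF _ has_derivative_ident] by metis
    qed
    \<comment> \<open>Back substitution in the triangular system: h' u = a gives u = k' a, and then
      G' u y + G x v = b is solved for v by applying \<open>S x\<close>.\<close>
    define A where "A = (\<lambda>(a, b). (k' a, blinfun_apply (S x) (b - blinfun_apply (G' (k' a)) y)))"
    have "(\<Psi> has_derivative A) (at v)"
    proof (rule has_derivative_inverse_basic)
      show "(\<Phi> has_derivative (\<lambda>(u, v). (h' u, blinfun_apply (G' u) y + blinfun_apply (G x) v))) (at (\<Psi> v))"
        using \<Phi>' xy(2) by simp
      have "bounded_linear (\<lambda>v. G' (k' (fst v)))"
        by (intro bounded_linear_compose[OF bl_G'] bounded_linear_compose[OF has_derivative_bounded_linear[OF k'(2)]]
            bounded_linear_fst)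
      then have "bounded_linear (\<lambda>v. blinfun_apply (S x) (snd v - blinfun_apply (G' (k' (fst v))) y))"
        by (intro bounded_linear_compose[OF blinfun.bounded_linear_right] bounded_linear_sub bounded_linear_snd
            bounded_linear_compose[OF blinfun.bounded_linear_left])
      moreover have "bounded_linear (\<lambda>v. k' (fst v))"
        by (intro bounded_linear_compose[OF has_derivative_bounded_linear[OF k'(2)]] bounded_linear_fst)
      ultimately show "bounded_linear A"
        unfolding A_def case_prod_beta by (intro bounded_linear_Pair)
      show "A \<circ> (\<lambda>(u, v). (h' u, blinfun_apply (G' u) y + blinfun_apply (G x) v)) = id"
        by (auto simp: A_def k'h' SG[OF x])
      show "continuous (at v) \<Psi>"
        using continuous_on_subset[OF cont_\<Psi>] cont_\<Psi> open_V z
        by (metis UNIV_I continuous_on_eq_continuous_at mem_Times_iff)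
    qed (use open_image v \<Phi>\<Psi> in auto)
    then have "(inv_into D \<Phi> has_derivative A) (at v)"
      by (rule has_derivative_transform_within_open[OF _ open_image v]) (simp add: inv\<Phi>)
    moreover have "complex_linear A"
      using k'(1) 1(2) unfolding complex_linear_def A_def
      by (auto simp: scaleC_prod_def blinfun.add_left blinfun.add_right blinfun.diff_right
          scaleC_blinfun.rep_eq linS[OF x] scaleC_add_right
          linear_diff[OF bounded_linear.linear[OF bounded_linear_scaleC_right]])
    ultimately show "\<exists>A. complex_linear A \<and> (inv_into D \<Phi> has_derivative A) (at v)" by blast
  qed (rule open_image)
  with inj\<Phi> hol_\<Phi> open_image show ?thesis by (simp add: biholomorphic_on_def)
qed

section \<open>Curves in the image of the extension operator\<close>

lemma L_exp_curve_in_extension_image: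
  fixes \<Gamma>h \<Gamma> :: "('x::complex_banach \<Rightarrow> 'x) \<Rightarrow> 'x \<Rightarrow> ('y::complex_banach \<Rightarrow>\<^sub>L 'y)"
  assumes p: "admissible_p p" and hat: "appropriate_hat p Kh \<Gamma>h" and app: "appropriate Kh \<Gamma>h K \<Gamma>"
    and h: "h \<in> K" and ht: "translate h (t *\<^sub>R \<tau>) \<in> K"
    and sub: "translate h (t *\<^sub>R \<tau>) ` unit_ball \<subseteq> h ` unit_ball"
    and t: "0 \<le> t" and \<Gamma>t: "\<And>x. x \<in> unit_ball \<Longrightarrow> \<Gamma> (translate h (t *\<^sub>R \<tau>)) x = L_exp (- (t *\<^sub>R C)) o\<^sub>L \<Gamma> h x"
    and B: "accretive B" and BC: "B o\<^sub>L C = C o\<^sub>L B"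
    and B\<Gamma>: "\<And>x. x \<in> unit_ball \<Longrightarrow> B o\<^sub>L \<Gamma> h x = \<Gamma> h x o\<^sub>L B"
    and zw: "(z, w) \<in> extension_op p \<Gamma> h ` DD p"
  shows "(z + t *\<^sub>R \<tau>, blinfun_apply (L_exp (- (t *\<^sub>R (B + C)))) w) \<in> extension_op p \<Gamma> h ` DD p"
proof -
  note bil = bounded_bilinear_blinfun_compose
  define ht where "ht = translate h (t *\<^sub>R \<tau>)"
  define g where "g = compose unit_ball (inv_into unit_ball h) ht"
  define EB EC where "EB = L_exp (- (t *\<^sub>R B))" and "EC = L_exp (- (t *\<^sub>R C))"
  obtain x y where xy: "(x, y) \<in> DD p" "z = h x" "w = blinfun_apply (\<Gamma> h x) y"
    using zw by (auto simp: extension_op_def)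
  have x: "x \<in> unit_ball" "norm x < 1" and y: "norm y < p (norm x)"
    using xy(1) by (auto simp: mem_DD_iff[OF p])
  have g: "g \<in> Kh" using app h ht sub by (auto simp: appropriate_def g_def ht_def)
  have "g \<in> Hol unit_ball unit_ball" using g hat by (auto simp: appropriate_hat_def)
  then have "g \<in> unit_ball \<rightarrow> unit_ball" by (simp add: Hol_def PiE_def)
  with x(1) have gx: "g x \<in> unit_ball" by (rule funcset_mem[rotated])
  have "h (g u) = ht u" if "u \<in> unit_ball" for u
    using sub that by (auto simp: g_def ht_def compose_def intro!: f_inv_into_f)
  \<comment> \<open>Off the ball both sides are \<open>undefined\<close>, so they are equal as
    functions and \<Gamma> may be evaluated at either. On the ball the image inclusion makes
    \<open>inv_into\<close> a genuine preimage.\<close>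
  then have hg: "compose unit_ball h g = ht" and hgx: "h (g x) = z + t *\<^sub>R \<tau>"
    using x xy(2) by (auto simp: compose_def ht_def translate_def fun_eq_iff)
  \<comment> \<open>The contraction acts on \<open>y\<close> before the cocycle does; afterwards it
    is moved past \<open>\<Gamma> h x\<close>, with which it commutes, to act on
    \<open>w\<close>.\<close>
  define y' where "y' = blinfun_apply (\<Gamma>h g x) (blinfun_apply EB y)"
  have "norm y' \<le> norm (\<Gamma>h g x) * norm (blinfun_apply EB y)"
    unfolding y'_def by (rule norm_blinfun)
  also have "\<dots> \<le> (p (norm (g x)) / p (norm x)) * norm y"
  proof (rule mult_mono)
    show "norm (\<Gamma>h g x) \<le> p (norm (g x)) / p (norm x)"
      using hat g x(1) by (simp add: appropriate_hat_def)
    show "norm (blinfun_apply EB y) \<le> norm y"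
      using norm_blinfun[of EB y] mult_right_mono[OF norm_L_exp_accretive[OF B t] norm_ge_zero[of y]]
      unfolding EB_def by linarith
    show "0 \<le> p (norm (g x)) / p (norm x)"
      using admissible_p_pos[OF p] gx x by (simp add: less_imp_le)
  qed simp
  \<comment> \<open>The inequality stays strict because both values of \<open>p\<close> are positive
    at points of the open ball.\<close>
  also have "\<dots> < (p (norm (g x)) / p (norm x)) * p (norm x)"
    using admissible_p_pos[OF p, of "norm x"] admissible_p_pos[OF p, of "norm (g x)"] gx x y
    by (intro mult_strict_left_mono) auto
  also have "\<dots> = p (norm (g x))" using admissible_p_pos[OF p, of "norm x"] x by simp
  finally have in_DD: "(g x, y') \<in> DD p" using gx by (simp add: mem_DD_iff[OF p])
  have "\<Gamma> h (g x) o\<^sub>L \<Gamma>h g x = EC o\<^sub>L \<Gamma> h x"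
    using app h g x(1) \<Gamma>t[OF x(1)] by (simp add: appropriate_def hg EC_def ht_def)
  then have "blinfun_apply (\<Gamma> h (g x)) y' = blinfun_apply (EC o\<^sub>L \<Gamma> h x) (blinfun_apply EB y)"
    unfolding y'_def by (metis blinfun_apply_blinfun_compose)
  also have "\<dots> = blinfun_apply EC (blinfun_apply (\<Gamma> h x o\<^sub>L EB) y)" by simp
  also have "\<Gamma> h x o\<^sub>L EB = EB o\<^sub>L \<Gamma> h x"
    unfolding EB_def using B\<Gamma>[OF x(1)]
    by (intro L_exp_commute[symmetric])
      (simp add: bounded_bilinear.minus_left[OF bil] bounded_bilinear.minus_right[OF bil]
        blinfun_compose_scaleR_left blinfun_compose_scaleR_right)
  also have "blinfun_apply EC (blinfun_apply (EB o\<^sub>L \<Gamma> h x) y) = blinfun_apply (EC o\<^sub>L EB) w"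
    by (simp add: xy(3))
  also have "EC o\<^sub>L EB = L_exp (- (t *\<^sub>R C) + - (t *\<^sub>R B))"
    unfolding EB_def EC_def
    by (rule L_exp_add[symmetric])
      (simp add: bounded_bilinear.minus_left[OF bil] bounded_bilinear.minus_right[OF bil]
        blinfun_compose_scaleR_left blinfun_compose_scaleR_right BC)
  also have "- (t *\<^sub>R C) + - (t *\<^sub>R B) = - (t *\<^sub>R (B + C))" by (simp add: scaleR_add_right)
  finally have "extension_op p \<Gamma> h (g x, y') = (z + t *\<^sub>R \<tau>, blinfun_apply (L_exp (- (t *\<^sub>R (B + C)))) w)"
    using in_DD hgx by (simp add: extension_op_def)
  then show ?thesis using in_DD by (metis imageI)
qed

lemma biholomorphic_on_extension_op:
  assumes p: "admissible_p p" and app: "appropriate Kh \<Gamma>h K \<Gamma>" and h: "h \<in> K"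
  shows "biholomorphic_on (extension_op p \<Gamma> h) (DD p)"
proof (rule biholomorphic_on_fibre_linear[where U = unit_ball and h = h and G = "\<Gamma> h"])
  show "open (DD p)" by (rule open_DD[OF p])
  show "DD p \<subseteq> unit_ball \<times> UNIV" by (auto simp: DD_def)
qed (use app h in \<open>auto simp: appropriate_def extension_op_def\<close>)

theorem theorem5p2:
  fixes p :: "real \<Rightarrow> real"
    and Kh K :: "('x::complex_banach \<Rightarrow> 'x) set"
    and \<Gamma>h \<Gamma> :: "('x \<Rightarrow> 'x) \<Rightarrow> 'x \<Rightarrow> ('y::complex_banach \<Rightarrow>\<^sub>L 'y)"
    and h :: "'x \<Rightarrow> 'x" and \<tau> :: 'x
  assumes "admissible_p p"
    and "appropriate_hat p Kh \<Gamma>h"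
    and "appropriate Kh \<Gamma>h K \<Gamma>"
    and "\<tau> \<in> frontier unit_ball"
    and "h \<in> Hol unit_ball UNIV"
    and "biholomorphic_on h unit_ball"
    and "convex_in_direction norm unit_ball h \<tau>"
    and "\<forall>t\<ge>0. translate h (t *\<^sub>R \<tau>) \<in> K"
  shows "(\<forall>C\<in>L_ops.
            (\<forall>t\<ge>0. \<forall>x\<in>unit_ball.
               \<Gamma> (translate h (t *\<^sub>R \<tau>)) x = L_exp (- (t *\<^sub>R C)) o\<^sub>L \<Gamma> h x) \<longrightarrow>
            (\<forall>z w. (z, w) \<in> extension_op p \<Gamma> h ` DD p \<longrightarrow>
               (\<forall>B\<in>L_ops.
                  accretive B \<and> B o\<^sub>L C = C o\<^sub>L B \<and>
                  (\<forall>x\<in>unit_ball. B o\<^sub>L \<Gamma> h x = \<Gamma> h x o\<^sub>L B) \<and>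
                  (\<forall>\<mu>\<in>L_spectrum (B + C). 0 \<le> Re \<mu>) \<longrightarrow>
                  {(z + t *\<^sub>R \<tau>, blinfun_apply (L_exp (- (t *\<^sub>R (B + C)))) w) | t. 0 \<le> t}
                    \<subseteq> extension_op p \<Gamma> h ` DD p)))
       \<and> ((\<forall>t\<ge>0. \<forall>x\<in>unit_ball. \<Gamma> (translate h (t *\<^sub>R \<tau>)) x = \<Gamma> h x) \<longrightarrow>
            convex_in_direction (minkowski_functional (DD p)) (DD p) (extension_op p \<Gamma> h) (\<tau>, 0))"
proof -
  have \<tau>: "norm \<tau> = 1" and dir: "\<And>w t. w \<in> h ` unit_ball \<Longrightarrow> 0 \<le> t \<Longrightarrow> w + t *\<^sub>R \<tau> \<in> h ` unit_ball"
    using assms(7) by (auto simp: convex_in_direction_def)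
  \<comment> \<open>The hypothesis on translates yields \<open>h\<close> itself at t = 0, since
    \<open>h\<close> is extensional.\<close>
  have "translate h (0 *\<^sub>R \<tau>) = h"
    using assms(5) by (auto simp: translate_def Hol_def PiE_def extensional_restrict)
  with assms(8) have h: "h \<in> K" by (metis order_refl)
  have sub: "translate h (t *\<^sub>R \<tau>) ` unit_ball \<subseteq> h ` unit_ball" if "0 \<le> t" for t
    using dir[OF _ that] by (auto simp: translate_def)
  have curve: "(z + t *\<^sub>R \<tau>, blinfun_apply (L_exp (- (t *\<^sub>R (B + C)))) w) \<in> extension_op p \<Gamma> h ` DD p"
    if "\<And>t x. 0 \<le> t \<Longrightarrow> x \<in> unit_ball \<Longrightarrow>
          \<Gamma> (translate h (t *\<^sub>R \<tau>)) x = L_exp (- (t *\<^sub>R C)) o\<^sub>L \<Gamma> h x"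
      and "(z, w) \<in> extension_op p \<Gamma> h ` DD p" "accretive B" "B o\<^sub>L C = C o\<^sub>L B"
      and "\<And>x. x \<in> unit_ball \<Longrightarrow> B o\<^sub>L \<Gamma> h x = \<Gamma> h x o\<^sub>L B" and "0 \<le> t" for B C z w t
    by (rule L_exp_curve_in_extension_image[OF assms(1-3) h _ sub]) (use that assms(8) in auto)
  have "convex_in_direction (minkowski_functional (DD p)) (DD p) (extension_op p \<Gamma> h) (\<tau>, 0)"
    if \<Gamma>: "\<forall>t\<ge>0. \<forall>x\<in>unit_ball. \<Gamma> (translate h (t *\<^sub>R \<tau>)) x = \<Gamma> h x"
    unfolding convex_in_direction_def
  proof (intro conjI ballI allI impI)
    fix v and t :: real assume v: "v \<in> extension_op p \<Gamma> h ` DD p" and t: "0 \<le> t"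
    \<comment> \<open>Taking B = C = 0 reduces the curve to a ray; the zero operator is accretive
      and commutes with everything.\<close>
    have "(fst v + t *\<^sub>R \<tau>, blinfun_apply (L_exp (- (t *\<^sub>R (0 + 0)))) (snd v)) \<in> extension_op p \<Gamma> h ` DD p"
      using \<Gamma> v t by (intro curve) (auto simp: accretive_def)
    then show "v + t *\<^sub>R (\<tau>, 0) \<in> extension_op p \<Gamma> h ` DD p"
      by (cases v) simp
  qed (use assms(1) \<tau> in \<open>auto intro: open_DD connected_DD minkowski_functional_DD_horizontal
        biholomorphic_on_extension_op[OF _ assms(3) h]\<close>)
  moreover have "{(z + t *\<^sub>R \<tau>, blinfun_apply (L_exp (- (t *\<^sub>R (B + C)))) w) | t. 0 \<le> t}
      \<subseteq> extension_op p \<Gamma> h ` DD p"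
    if "\<forall>t\<ge>0. \<forall>x\<in>unit_ball. \<Gamma> (translate h (t *\<^sub>R \<tau>)) x = L_exp (- (t *\<^sub>R C)) o\<^sub>L \<Gamma> h x"
      and "(z, w) \<in> extension_op p \<Gamma> h ` DD p" "accretive B" "B o\<^sub>L C = C o\<^sub>L B"
      and "\<forall>x\<in>unit_ball. B o\<^sub>L \<Gamma> h x = \<Gamma> h x o\<^sub>L B" for B C z w
    using curve[of C z w B] that by blast
  ultimately show ?thesis by (intro conjI ballI allI impI) (blast+)
qed

end
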